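(* Let $\mathcal L(\lambda)=\begin{bmatrix}M(\lambda)&K_2(\lambda)^T\\ K_1(\lambda)&0\end{bmatrix}$ be a strong block minimal bases degree-$\ell$ matrix polynomial, let $N_1(\lambda)$ and $N_2(\lambda)$ be minimal bases dual to $K_1(\lambda)$ and $K_2(\lambda)$, respectively, and let $Q(\lambda):=N_2(\lambda)M(\lambda)N_1(\lambda)^T$. For $i=1,2$ let $$U_i(\lambda)=\begin{bmatrix}K_i(\lambda)\\ \widehat K_i(\lambda)\end{bmatrix}\quad\text{be unimodular with}\quad U_i(\lambda)^{-1}=\begin{bmatrix}\widehat N_i(\lambda)^T&N_i(\lambda)^T\end{bmatrix}.$$ Let the $p$ columns of $R_{\mathcal L}(\lambda)$ be a right minimal basis of $\mathcal L(\lambda)$, and let the $q$ rows of $L_{\mathcal L}(\lambda)$ be a left minimal basis of $\mathcal L(\lambda)$. Then: (a) The $p$ columns of $R_Q(\lambda):=\begin{bmatrix}\widehat K_1(\lambda)&0\end{bmatrix}R_{\mathcal L}(\lambda)$ are a right minimal basis of $Q(\lambda)$. (b) The $q$ rows of $L_Q(\lambda):=L_{\mathcal L}(\lambda)\begin{bmatrix}\widehat K_2(\lambda)^T\\ 0\end{bmatrix}$ are a left minimal basis of $Q(\lambda)$.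
   Context: $\mathbb F$ is an arbitrary field; all matrix polynomials have coefficients in $\mathbb F$. A matrix polynomial has grade $g$ if it can be written $\sum_{i=0}^gP_i\lambda^i$ (coefficients possibly zero). A square matrix polynomial is unimodular if its determinant is a nonzero constant. A minimal basis of a subspace of $\mathbb F(\lambda)^q$ is a basis of vector polynomials whose sum of degrees is least among all bases of vector polynomials. A $p\times q$ matrix polynomial ($p<q$) is called a minimal basis if its rows form a minimal basis of the rational subspace they span. Row degrees are the degrees of the rows. $K(\lambda)\in\mathbb F[\lambda]^{p_1\times q}$ and $N(\lambda)\in\mathbb F[\lambda]^{p_2\times q}$ are dual minimal bases (each is a minimal basis dual to the other) if $p_1+p_2=q$, $K(\lambda)N(\lambda)^T=0$, and both are minimal bases. A right (left) minimal basis of a matrix polynomial $P(\lambda)$ is a minimal basis of the $\mathbb F(\lambda)$-space $\{x(\lambda):P(\lambda)x(\lambda)=0\}$ (of $\{y(\lambda)^T:y(\lambda)^TP(\lambda)=0\}$). Strong block minimal bases degree-$\ell$ matrix polynomial ($\ell>0$): $\mathcal L(\lambda)=\begin{bmatrix}M(\lambda)&K_2(\lambda)^T\\ K_1(\lambda)&0\end{bmatrix}$ with $M(\lambda)$ of size $(m+m_2)\times(n+m_1)$ and grade $\ell$, $K_1(\lambda)\in\mathbb F[\lambda]^{m_1\times(n+m_1)}$ and $K_2(\lambda)\in\mathbb F[\lambda]^{m_2\times(m+m_2)}$ minimal bases with all row degrees equal to $\ell$, such that the row degrees of a minimal basis dual to $K_1(\lambda)$ are all equal, and the row degrees of a minimal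 basis dual to $K_2(\lambda)$ are all equal. Thus $Q(\lambda)$ is $m\times n$. Degenerate cases where exactly one of $K_1,K_2$ is absent ($m_1=0$ or $m_2=0$) are allowed; then for the absent index $N_i=\widehat K_i=I$ and $\widehat N_i$ is empty. For a pair of dual minimal bases $(K_i,N_i)$, unimodular matrices $U_i$ as in the claim always exist. *)

theory Defs
  imports
    "Jordan_Normal_Form.VS_Connect"
    "Jordan_Normal_Form.Matrix_Kernel"
    "HOL-Computational_Algebra.Normalized_Fraction"
begin

text \<open>
  Matrix polynomials over \<open>\<bbbF>\<close> are matrices of type \<open>'a poly mat\<close> with \<open>'a :: field\<close>. Rational
  vectors are vectors over the fraction field \<open>'a poly fract\<close>, and polynomials are embedded
  by \<open>to_fract\<close>. Matrices with zero rows or zero columns are admitted.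
\<close>

definition append_cols :: "'a :: zero mat \<Rightarrow> 'a mat \<Rightarrow> 'a mat" (infixr \<open>@\<^sub>c\<close> 65) where
  "A @\<^sub>c B = four_block_mat A B (0\<^sub>m 0 (dim_col A)) (0\<^sub>m 0 (dim_col B))"

text \<open>The inserted 0 only matters for vectors of length 0.\<close>

definition vec_degree :: "'a :: zero poly vec \<Rightarrow> nat" where
  "vec_degree v = Max (insert 0 (degree ` vec_set v))"

definition row_degrees :: "'a :: zero poly mat \<Rightarrow> nat list" where
  "row_degrees A = map vec_degree (rows A)"

definition has_grade :: "nat \<Rightarrow> 'a :: zero poly mat \<Rightarrow> bool" where
  "has_grade g A \<longleftrightarrow> (\<forall>i < dim_row A. \<forall>j < dim_col A. degree (A $$ (i, j)) \<le> g)"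

definition unimodular :: "'a :: field poly mat \<Rightarrow> bool" where
  "unimodular U \<longleftrightarrow> square_mat U \<and> (\<exists>c. c \<noteq> 0 \<and> det U = [:c:])"

text \<open>
  The vector polynomials in the list \<open>vs\<close> form a basis of the subspace \<open>W\<close> of \<open>\<bbbF>(\<lambda>)\<^sup>q\<close>. Bases are
  lists because they arise as the rows or columns of matrices; \<open>distinct\<close> excludes repeated
  vectors, which the library's set-based notion of basis cannot see.
\<close>

definition poly_basis :: "nat \<Rightarrow> 'a :: field poly fract vec set \<Rightarrow> 'a poly vec list \<Rightarrow> bool" where
  "poly_basis q W vs \<longleftrightarrow>
     set vs \<subseteq> carrier_vec q \<and> distinct vs \<and>
     vectorspace.basis class_ring ((module_vec TYPE('a poly fract) q)\<lparr>carrier := W\<rparr>)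
       (map_vec to_fract ` set vs)"

definition minimal_basis_of :: "nat \<Rightarrow> 'a :: field poly fract vec set \<Rightarrow> 'a poly vec list \<Rightarrow> bool" where
  "minimal_basis_of q W vs \<longleftrightarrow>
     poly_basis q W vs \<and>
     (\<forall>ws. poly_basis q W ws \<longrightarrow> sum_list (map vec_degree vs) \<le> sum_list (map vec_degree ws))"

definition minimal_basis :: "'a :: field poly mat \<Rightarrow> bool" where
  "minimal_basis K \<longleftrightarrow>
     dim_row K < dim_col K \<and>
     minimal_basis_of (dim_col K) (vec_space.row_space (dim_col K) (map_mat to_fract K)) (rows K)"

definition dual_minimal_bases :: "'a :: field poly mat \<Rightarrow> 'a poly mat \<Rightarrow> bool" where
  "dual_minimal_bases K N \<longleftrightarrow>
     dim_col K = dim_col N \<and> dim_row K + dim_row N = dim_col K \<and>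
     K * transpose_mat N = 0\<^sub>m (dim_row K) (dim_row N) \<and>
     minimal_basis K \<and> minimal_basis N"

text \<open>The columns of \<open>R\<close> form a right minimal basis of \<open>P\<close>.\<close>

definition right_minimal_basis :: "'a :: field poly mat \<Rightarrow> 'a poly mat \<Rightarrow> bool" where
  "right_minimal_basis P R \<longleftrightarrow>
     dim_row R = dim_col P \<and>
     minimal_basis_of (dim_col P) (mat_kernel (map_mat to_fract P)) (cols R)"

text \<open>
  The rows of \<open>L\<close> form a left minimal basis of \<open>P\<close>; the equation \<open>y\<^sup>T P = 0\<close> is written as
  \<open>P\<^sup>T y = 0\<close>, since rows and columns are vectors of the same type.
\<close>

definition left_minimal_basis :: "'a :: field poly mat \<Rightarrow> 'a poly mat \<Rightarrow> bool" where
  "left_minimal_basis P L \<longleftrightarrow>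
     dim_col L = dim_row P \<and>
     minimal_basis_of (dim_row P) (mat_kernel (transpose_mat (map_mat to_fract P))) (rows L)"

text \<open>
  All row degrees of \<open>K\<close> equal \<open>l\<close>, and a minimal basis dual to \<open>K\<close> has equal row degrees. The row
  degrees of dual minimal bases of \<open>K\<close> do not depend on the choice of the basis, up to order.
\<close>

definition minimal_basis_block :: "nat \<Rightarrow> 'a :: field poly mat \<Rightarrow> bool" where
  "minimal_basis_block l K \<longleftrightarrow>
     minimal_basis K \<and> (\<forall>d \<in> set (row_degrees K). d = l) \<and>
     (\<exists>N. dual_minimal_bases K N \<and> (\<exists>d. \<forall>e \<in> set (row_degrees N). e = d))"

text \<open>
  The blocks of a strong block minimal bases degree-\<open>l\<close> matrix polynomial. The block \<open>K\<^sub>i\<close> is absent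
  if \<open>m\<^sub>i = 0\<close>, in which case it is the empty matrix with zero rows; at most one of the two blocks
  may be absent.
\<close>

definition strong_block_minimal_bases ::
  "nat \<Rightarrow> nat \<Rightarrow> nat \<Rightarrow> nat \<Rightarrow> nat \<Rightarrow> 'a :: field poly mat \<Rightarrow> 'a poly mat \<Rightarrow> 'a poly mat \<Rightarrow> bool" where
  "strong_block_minimal_bases l m n m\<^sub>1 m\<^sub>2 M K\<^sub>1 K\<^sub>2 \<longleftrightarrow>
     0 < l \<and> (0 < m\<^sub>1 \<or> 0 < m\<^sub>2) \<and>
     M \<in> carrier_mat (m + m\<^sub>2) (n + m\<^sub>1) \<and> has_grade l M \<and>
     K\<^sub>1 \<in> carrier_mat m\<^sub>1 (n + m\<^sub>1) \<and> (0 < m\<^sub>1 \<longrightarrow> minimal_basis_block l K\<^sub>1) \<and>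
     K\<^sub>2 \<in> carrier_mat m\<^sub>2 (m + m\<^sub>2) \<and> (0 < m\<^sub>2 \<longrightarrow> minimal_basis_block l K\<^sub>2)"

definition block_matrix :: "'a :: zero mat \<Rightarrow> 'a mat \<Rightarrow> 'a mat \<Rightarrow> 'a mat" where
  "block_matrix M K\<^sub>1 K\<^sub>2 =
     four_block_mat M (transpose_mat K\<^sub>2) K\<^sub>1 (0\<^sub>m (dim_row K\<^sub>1) (dim_row K\<^sub>2))"

text \<open>
  \<open>N\<close> is a minimal basis dual to \<open>K\<close>, and \<open>Khat\<close>, \<open>Nhat\<close> complete \<open>K\<close>, \<open>N\<close> to a unimodular matrix and
  its inverse. If \<open>K\<close> is absent, i.e. has no rows, then \<open>N = Khat = I\<close> and \<open>Nhat\<close> is empty.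
\<close>

definition dual_unimodular_completion ::
  "'a :: field poly mat \<Rightarrow> 'a poly mat \<Rightarrow> 'a poly mat \<Rightarrow> 'a poly mat \<Rightarrow> bool" where
  "dual_unimodular_completion K N Khat Nhat \<longleftrightarrow>
     dim_col Khat = dim_col K \<and> dim_col Nhat = dim_col K \<and>
     dim_row Khat = dim_row N \<and> dim_row Nhat = dim_row K \<and>
     (if dim_row K = 0 then N = 1\<^sub>m (dim_col K) \<and> Khat = 1\<^sub>m (dim_col K)
      else dual_minimal_bases K N) \<and>
     (let U = K @\<^sub>r Khat; V = transpose_mat Nhat @\<^sub>c transpose_mat N
      in unimodular U \<and> inverts_mat U V \<and> inverts_mat V U)"

end

theory Submission
  imports Defs "Jordan_Normal_Form.DL_Rank"
begin

text \<open>
  Let \<open>z\<close> be in the kernel of \<open>Q = N\<^sub>2 M N\<^sub>1\<^sup>T\<close>. The vector with the upper part \<open>x = N\<^sub>1\<^sup>T z\<close> and the lower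
  part \<open>y = - Nhat\<^sub>2 M x\<close> is in the kernel of the block matrix, and \<open>z\<close> is recovered from it as
  \<open>Khat\<^sub>1 x\<close>. This is an isomorphism between the two rational kernels, and it is given by polynomial
  matrices in both directions (locale \<open>completed_block_matrix\<close>).

  The isomorphism shifts the degree of every nonzero vector polynomial by the same constant
  (\<open>lift_degree\<close>). Indeed, a minimal basis with equal row degrees \<open>d\<close> has the predictable degree
  property: combining its rows with a polynomial coefficient vector \<open>z\<close> gives a vector of degree
  exactly \<open>d + deg z\<close> (\<open>minimal_basis_shifts_degree\<close>), because otherwise some combination with
  constant coefficients would have degree less than \<open>d\<close> and could replace a basis vector. For \<open>N\<^sub>1\<close>
  this yields \<open>deg x = d + deg z\<close>, once its row degrees are known to be equal to those of the dual
  minimal basis in the definition (\<open>dual_minimal_basis_shifts_degree\<close>). For \<open>K\<^sub>2\<close>, all of whose row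
  degrees are equal to the grade \<open>l\<close> of \<open>M\<close>, the equation \<open>M x + K\<^sub>2\<^sup>T y = 0\<close> yields \<open>deg y \<le> deg x\<close>.

  A polynomial isomorphism that shifts all degrees by a constant changes the degree sum of all
  bases by the same amount and therefore preserves minimality (\<open>minimal_basis_transfer\<close>). This is
  part (a); part (b) is part (a) for the transposed matrix, which has the same block structure with
  the indices 1 and 2 exchanged.
\<close>

section \<open>Bases as injective matrices\<close>

interpretation to_fract: inj_comm_ring_hom to_fract
  by unfold_locales auto

text \<open>
  A basis is encoded by the matrix \<open>B\<close> that has it as columns: \<open>c \<mapsto> B c\<close> is a bijection onto \<open>W\<close>.
  In this form the image of a basis under a matrix and the exchange of a basis vector become
  matrix computations, and repeated columns are excluded by injectivity.
\<close>

definition column_basis :: "'k :: field vec set \<Rightarrow> 'k mat \<Rightarrow> bool" where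
  "column_basis W B \<longleftrightarrow>
     (\<lambda>c. B *\<^sub>v c) ` carrier_vec (dim_col B) = W \<and>
     (\<forall>c \<in> carrier_vec (dim_col B). B *\<^sub>v c = 0\<^sub>v (dim_row B) \<longrightarrow> c = 0\<^sub>v (dim_col B))"

lemma column_basisD:
  assumes "column_basis W B" "B \<in> carrier_mat q p"
  shows "c \<in> carrier_vec p \<Longrightarrow> B *\<^sub>v c \<in> W"
    and "w \<in> W \<Longrightarrow> \<exists>c \<in> carrier_vec p. w = B *\<^sub>v c"
    and "c \<in> carrier_vec p \<Longrightarrow> B *\<^sub>v c = 0\<^sub>v q \<Longrightarrow> c = 0\<^sub>v p"
  using assms unfolding column_basis_def by auto

lemma column_basisI:
  assumes "B \<in> carrier_mat q p"
    and "\<And>c. c \<in> carrier_vec p \<Longrightarrow> B *\<^sub>v c \<in> W"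
    and "\<And>w. w \<in> W \<Longrightarrow> \<exists>c \<in> carrier_vec p. w = B *\<^sub>v c"
    and "\<And>c. c \<in> carrier_vec p \<Longrightarrow> B *\<^sub>v c = 0\<^sub>v q \<Longrightarrow> c = 0\<^sub>v p"
  shows "column_basis W B"
  using assms unfolding column_basis_def by auto

lemma col_eq_mult_unit_vec:
  assumes "(B :: 'k :: field mat) \<in> carrier_mat q p" "j < p"
  shows "col B j = B *\<^sub>v unit_vec p j"
  using assms by (intro eq_vecI) auto

lemma column_basis_iff:
  fixes B :: "'k :: field mat"
  assumes B: "B \<in> carrier_mat q p"
    and W: "submodule class_ring W (module_vec TYPE('k) q)"
  shows "column_basis W B \<longleftrightarrow> distinct (cols B) \<and>
    vectorspace.basis class_ring ((module_vec TYPE('k) q)\<lparr>carrier := W\<rparr>) (set (cols B))"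
proof -
  interpret vec_space "TYPE('k)" q .
  have subW: "subspace class_ring W V"
    using W vec_vs by (simp add: subspace_def)
  interpret W: vectorspace class_ring "vs W"
    using subspace_is_vs[OF subW] .
  have span: "span (set (cols B)) = (\<lambda>c. B *\<^sub>v c) ` carrier_vec p"
    using col_space_eq[OF B] B unfolding col_space_def by auto
  have indpt: "distinct (cols B) \<and> lin_indpt (set (cols B)) \<longleftrightarrow>
    (\<forall>c \<in> carrier_vec p. B *\<^sub>v c = 0\<^sub>v q \<longrightarrow> c = 0\<^sub>v p)" (is "?L \<longleftrightarrow> ?R")
  proof
    assume ?L then show ?R using lin_depI[OF B] by metis
  next
    assume R: ?R
    have "distinct (cols B)"
    proof (rule ccontr)
      assume "\<not> distinct (cols B)"
      then obtain i j where ij: "i < p" "j < p" "i \<noteq> j" "col B i = col B j"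
        using B unfolding distinct_conv_nth by auto
      have "B *\<^sub>v (unit_vec p i - unit_vec p j) = 0\<^sub>v q"
        using ij B by (simp add: mult_minus_distrib_mat_vec[OF B] col_eq_mult_unit_vec[OF B, symmetric])
      then have "unit_vec p i - unit_vec p j = (0\<^sub>v p :: 'k vec)"
        using R by (metis minus_carrier_vec unit_vec_carrier)
      then have "(unit_vec p i - unit_vec p j) $ i = (0\<^sub>v p :: 'k vec) $ i" by simp
      then show False using ij by simp
    qed
    moreover have "lin_indpt (set (cols B))"
      using lin_depE[OF B _ \<open>distinct (cols B)\<close>] R by metis
    ultimately show ?L by simp
  qed
  show ?thesis
  proof
    assume L: "column_basis W B"
    have sub: "set (cols B) \<subseteq> W"
      using column_basisD(1)[OF L B] col_eq_mult_unit_vec[OF B] B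
      by (auto simp: cols_def)
    show "distinct (cols B) \<and> W.basis (set (cols B))"
      using L sub span_li_not_depend[OF sub W] indpt span B
      unfolding W.basis_def column_basis_def by auto
  next
    assume R: "distinct (cols B) \<and> W.basis (set (cols B))"
    then have sub: "set (cols B) \<subseteq> W" unfolding W.basis_def by simp
    show "column_basis W B"
      using R span_li_not_depend[OF sub W] indpt span B
      unfolding W.basis_def column_basis_def by auto
  qed
qed

text \<open>
  The embedding into the fraction field is injective, so distinctness of the polynomial columns
  and of their images agree.
\<close>

lemma poly_basis_cols_iff:
  fixes R :: "'a :: field poly mat"
  assumes R: "R \<in> carrier_mat q p"
    and W: "submodule class_ring W (module_vec TYPE('a poly fract) q)"
  shows "poly_basis q W (cols R) \<longleftrightarrow> column_basis W (map_mat to_fract R)"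
proof -
  have cols: "cols (map_mat to_fract R) = map (map_vec to_fract) (cols R)"
    by (rule nth_equalityI) auto
  have inj: "inj (map_vec (to_fract :: 'a poly \<Rightarrow> _))"
    by (auto intro!: injI simp: vec_eq_iff)
  have "distinct (cols (map_mat to_fract R)) \<longleftrightarrow> distinct (cols R)"
    unfolding cols distinct_map using inj by (auto intro: inj_on_subset)
  moreover have "set (cols R) \<subseteq> carrier_vec q" using R cols_dim by blast
  ultimately show ?thesis
    using column_basis_iff[of "map_mat to_fract R" q p W] R W
    unfolding poly_basis_def cols by auto
qed

lemma poly_basis_as_cols:
  assumes "poly_basis q W vs"
  shows "cols (mat_of_cols q vs) = vs"
  using assms unfolding poly_basis_def by simp

lemma poly_basis_length_eq:
  fixes W :: "'a :: field poly fract vec set"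
  assumes W: "submodule class_ring W (module_vec TYPE('a poly fract) q)"
    and xs: "poly_basis q W xs" and ys: "poly_basis q W ys"
  shows "length xs = length ys"
proof -
  interpret vec_space "TYPE('a poly fract)" q .
  interpret W: vectorspace class_ring "vs W"
    using subspace_is_vs[of W] W vectorspace_axioms by (simp add: subspace_def)
  have inj: "inj (map_vec (to_fract :: 'a poly \<Rightarrow> _))"
    by (auto intro!: injI simp: vec_eq_iff)
  have "W.dim = length us" if "poly_basis q W us" for us
  proof -
    have "W.dim = card (map_vec to_fract ` set us)"
      using that by (intro W.dim_basis) (auto simp: poly_basis_def)
    also have "\<dots> = length us"
      using that inj by (simp add: poly_basis_def card_image distinct_card inj_on_subset)
    finally show ?thesis .
  qed
  then show ?thesis using xs ys by metis
qed

section \<open>Degrees of vector polynomials\<close>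

lemma vec_degree_le_iff: "vec_degree v \<le> d \<longleftrightarrow> (\<forall>i < dim_vec v. degree (v $ i) \<le> d)"
  unfolding vec_degree_def vec_set_def by auto

lemma degree_le_vec_degree: "i < dim_vec v \<Longrightarrow> degree (v $ i) \<le> vec_degree v"
  using vec_degree_le_iff by blast

lemma vec_degree_attained:
  assumes "v \<in> carrier_vec q" "v \<noteq> 0\<^sub>v q"
  obtains i where "i < q" "coeff (v $ i) (vec_degree v) \<noteq> 0"
proof (cases "vec_degree v = 0")
  case True
  obtain i where i: "i < q" "v $ i \<noteq> 0"
    using assms by (metis carrier_vecD eq_vecI index_zero_vec)
  have "degree (v $ i) = 0"
    using degree_le_vec_degree[of i v] True i assms by simp
  then have "coeff (v $ i) (vec_degree v) \<noteq> 0"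
    using i True by (metis leading_coeff_0_iff)
  then show ?thesis using that i by blast
next
  case False
  have "vec_degree v \<in> insert 0 (degree ` vec_set v)"
    unfolding vec_degree_def by (intro Max_in) (auto simp: vec_set_def)
  then obtain i where i: "i < q" "degree (v $ i) = vec_degree v"
    using False assms by (auto simp: vec_set_def)
  then have "v $ i \<noteq> 0" using False by auto
  then show ?thesis using that i by (metis leading_coeff_0_iff)
qed

lemma le_vec_degree:
  assumes "v \<in> carrier_vec q" "i < q" "coeff (v $ i) d \<noteq> 0"
  shows "d \<le> vec_degree v"
  using assms le_degree degree_le_vec_degree by (metis carrier_vecD le_trans)

text \<open>
  The predictable degree property for a matrix all of whose columns have degree \<open>d\<close>: in \<open>B z\<close> the
  leading coefficients never cancel.
\<close>

definition shifts_degree :: "nat \<Rightarrow> 'a :: field poly mat \<Rightarrow> bool" where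
  "shifts_degree d B \<longleftrightarrow>
     (\<forall>z \<in> carrier_vec (dim_col B). z \<noteq> 0\<^sub>v (dim_col B) \<longrightarrow>
        vec_degree (B *\<^sub>v z) = d + vec_degree z)"

lemma degree_mult_mat_vec_le:
  fixes B :: "'a :: field poly mat"
  assumes B: "B \<in> carrier_mat q p" and z: "z \<in> carrier_vec p"
    and deg: "has_grade d B"
  shows "vec_degree (B *\<^sub>v z) \<le> d + vec_degree z"
  unfolding vec_degree_le_iff
proof (intro allI impI)
  fix i assume i: "i < dim_vec (B *\<^sub>v z)"
  have "degree (B $$ (i, j) * z $ j) \<le> d + vec_degree z" if "j < p" for j
  proof -
    have "degree (B $$ (i, j)) \<le> d" using deg B i that unfolding has_grade_def by simp
    moreover have "degree (z $ j) \<le> vec_degree z"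
      using degree_le_vec_degree[of j z] that z by simp
    ultimately show ?thesis using degree_mult_le[of "B $$ (i, j)" "z $ j"] by linarith
  qed
  then have "degree (\<Sum>j<p. B $$ (i, j) * z $ j) \<le> d + vec_degree z"
    by (intro degree_sum_le) auto
  then show "degree ((B *\<^sub>v z) $ i) \<le> d + vec_degree z"
    using B z i by (simp add: scalar_prod_def lessThan_atLeast0)
qed

lemma coeff_mult_degree_bounds:
  fixes f g :: "'a :: comm_semiring_0 poly"
  assumes "degree f \<le> d" "degree g \<le> e"
  shows "coeff (f * g) (d + e) = coeff f d * coeff g e"
proof -
  have "coeff f i * coeff g (d + e - i) = (if i = d then coeff f d * coeff g e else 0)" for i
    using assms by (cases i d rule: linorder_cases) (auto simp: coeff_eq_0)
  then show ?thesis by (simp add: coeff_mult)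
qed

text \<open>
  The coefficient of \<open>B z\<close> at \<open>d + deg z\<close> is \<open>B\<^sub>d c\<close>, where \<open>B\<^sub>d\<close> collects the coefficients of \<open>B\<close> at \<open>d\<close>
  and \<open>c\<close> is the leading coefficient vector of \<open>z\<close>. The same vector \<open>B\<^sub>d c\<close> is the coefficient
  at \<open>d\<close> of the combination \<open>B c\<close> with constant coefficients, and it does not vanish because \<open>B c\<close>
  is nonzero of degree at least \<open>d\<close>. Hence it suffices to bound the degrees of the vectors \<open>B c\<close>
  from below.
\<close>

lemma shifts_degreeI:
  fixes B :: "'a :: field poly mat"
  assumes B: "B \<in> carrier_mat q p" and deg: "has_grade d B"
    and inj: "\<And>c. c \<in> carrier_vec p \<Longrightarrow> c \<noteq> 0\<^sub>v p \<Longrightarrow> B *\<^sub>v c \<noteq> 0\<^sub>v q"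
    and lower: "\<And>c. c \<in> carrier_vec p \<Longrightarrow> c \<noteq> 0\<^sub>v p \<Longrightarrow> d \<le> vec_degree (B *\<^sub>v c)"
  shows "shifts_degree d B"
  unfolding shifts_degree_def
proof (intro ballI impI)
  fix z :: "'a poly vec"
  assume "z \<in> carrier_vec (dim_col B)" "z \<noteq> 0\<^sub>v (dim_col B)"
  with B have z: "z \<in> carrier_vec p" "z \<noteq> 0\<^sub>v p" by auto
  let ?e = "vec_degree z"
  define c where "c = map_vec (\<lambda>f. [:coeff f ?e:]) z"
  have c: "c \<in> carrier_vec p" using z by (simp add: c_def)
  obtain j where "j < p" "coeff (z $ j) ?e \<noteq> 0"
    using vec_degree_attained[OF z] by blast
  then have "c $ j \<noteq> 0" "j < p" using z by (auto simp: c_def)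
  then have c0: "c \<noteq> 0\<^sub>v p" by auto
  have c_deg: "vec_degree c \<le> 0" unfolding vec_degree_le_iff by (auto simp: c_def)
  have "vec_degree (B *\<^sub>v c) = d"
    using degree_mult_mat_vec_le[OF B c deg] lower[OF c c0] c_deg by linarith
  moreover obtain i where i: "i < q" "coeff ((B *\<^sub>v c) $ i) (vec_degree (B *\<^sub>v c)) \<noteq> 0"
    using vec_degree_attained[of "B *\<^sub>v c" q] inj[OF c c0] B by (metis mult_mat_vec_carrier c)
  ultimately have lead: "coeff ((B *\<^sub>v c) $ i) d \<noteq> 0" by simp
  have summand: "coeff (B $$ (i, j) * z $ j) (d + ?e) = coeff (B $$ (i, j) * c $ j) d"
    if j: "j < p" for j
  proof -
    have le: "degree (B $$ (i, j)) \<le> d" "degree (z $ j) \<le> ?e"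
      using deg B i j degree_le_vec_degree[of j z] z unfolding has_grade_def by auto
    have "coeff (B $$ (i, j) * z $ j) (d + ?e) = coeff (B $$ (i, j)) d * coeff (z $ j) ?e"
      using le by (rule coeff_mult_degree_bounds)
    also have "\<dots> = coeff (B $$ (i, j) * c $ j) d"
      using z j by (simp add: c_def)
    finally show ?thesis .
  qed
  have "coeff ((B *\<^sub>v z) $ i) (d + ?e) = coeff ((B *\<^sub>v c) $ i) d"
    using B z c i by (simp add: scalar_prod_def coeff_sum summand)
  then have "d + ?e \<le> vec_degree (B *\<^sub>v z)"
    using lead i B z by (intro le_vec_degree[of _ q i]) auto
  then show "vec_degree (B *\<^sub>v z) = d + ?e"
    using degree_mult_mat_vec_le[OF B z(1) deg] by simp
qed

section \<open>Minimal bases under degree-shifting isomorphisms\<close>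

lemma column_basis_transfer:
  fixes A B X :: "'k :: field mat"
  assumes X: "column_basis W X" "X \<in> carrier_mat q p"
    and A: "A \<in> carrier_mat q' q" and B: "B \<in> carrier_mat q q'"
    and AW: "\<And>w. w \<in> W \<Longrightarrow> A *\<^sub>v w \<in> W'" and BA: "\<And>w. w \<in> W \<Longrightarrow> B *\<^sub>v (A *\<^sub>v w) = w"
    and BW: "\<And>w. w \<in> W' \<Longrightarrow> B *\<^sub>v w \<in> W" and AB: "\<And>w. w \<in> W' \<Longrightarrow> A *\<^sub>v (B *\<^sub>v w) = w"
  shows "column_basis W' (A * X)"
proof (rule column_basisI)
  show "A * X \<in> carrier_mat q' p" using A X by simp
  show "A * X *\<^sub>v c \<in> W'" if "c \<in> carrier_vec p" for c
    using column_basisD(1)[OF X that] AW assoc_mult_mat_vec[OF A X(2) that] by simp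
  show "\<exists>c \<in> carrier_vec p. w = A * X *\<^sub>v c" if "w \<in> W'" for w
    using column_basisD(2)[OF X BW[OF that]] AB[OF that] assoc_mult_mat_vec[OF A X(2)] by metis
  show "c = 0\<^sub>v p" if c: "c \<in> carrier_vec p" "A * X *\<^sub>v c = 0\<^sub>v q'" for c
  proof -
    have "X *\<^sub>v c = B *\<^sub>v (A *\<^sub>v (X *\<^sub>v c))" using BA[OF column_basisD(1)[OF X c(1)]] by simp
    also have "\<dots> = B *\<^sub>v 0\<^sub>v q'" using c assoc_mult_mat_vec[OF A X(2) c(1)] by simp
    also have "\<dots> = 0\<^sub>v q" using B by (intro eq_vecI) auto
    finally show ?thesis using column_basisD(3)[OF X c(1)] by simp
  qed
qed

lemma column_basis_col:
  fixes R :: "'a :: field poly mat"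
  assumes R: "column_basis W (map_mat to_fract R)" "R \<in> carrier_mat q p" and j: "j < p"
  shows "map_vec to_fract (col R j) \<in> W" and "col R j \<noteq> 0\<^sub>v q"
proof -
  have R': "map_mat to_fract R \<in> carrier_mat q p" using R by simp
  have eq: "map_vec to_fract (col R j) = map_mat to_fract R *\<^sub>v unit_vec p j"
    using col_eq_mult_unit_vec[OF R' j] R j by simp
  show "map_vec to_fract (col R j) \<in> W"
    unfolding eq using column_basisD(1)[OF R(1) R'] by simp
  show "col R j \<noteq> 0\<^sub>v q"
  proof
    assume "col R j = 0\<^sub>v q"
    then have "map_mat to_fract R *\<^sub>v unit_vec p j = 0\<^sub>v q"
      using eq by (simp add: to_fract.vec_hom_zero)
    then have "unit_vec p j = (0\<^sub>v p :: 'a poly fract vec)"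
      using column_basisD(3)[OF R(1) R'] by simp
    then show False using j by simp
  qed
qed

text \<open>
  All bases of \<open>W\<close> and \<open>W'\<close> have the same number \<open>p\<close> of elements, so passing from a basis of \<open>W'\<close> to its
  image under \<open>B\<close> adds the constant \<open>p * d\<close> to the sum of the degrees. Since \<open>A\<close> and \<open>B\<close> are
  polynomial, bases of vector polynomials correspond to each other, and so do those of least degree
  sum.
\<close>

lemma minimal_basis_transfer:
  fixes A B R :: "'a :: field poly mat"
  defines "A' \<equiv> map_mat to_fract A" and "B' \<equiv> map_mat to_fract B"
  assumes W: "submodule class_ring W (module_vec TYPE('a poly fract) q)"
    and W': "submodule class_ring W' (module_vec TYPE('a poly fract) q')"
    and A: "A \<in> carrier_mat q' q" and B: "B \<in> carrier_mat q q'"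
    and AW: "\<And>w. w \<in> W \<Longrightarrow> A' *\<^sub>v w \<in> W'" and BA: "\<And>w. w \<in> W \<Longrightarrow> B' *\<^sub>v (A' *\<^sub>v w) = w"
    and BW: "\<And>w. w \<in> W' \<Longrightarrow> B' *\<^sub>v w \<in> W" and AB: "\<And>w. w \<in> W' \<Longrightarrow> A' *\<^sub>v (B' *\<^sub>v w) = w"
    and deg: "\<And>z. z \<in> carrier_vec q' \<Longrightarrow> z \<noteq> 0\<^sub>v q' \<Longrightarrow> map_vec to_fract z \<in> W' \<Longrightarrow>
      vec_degree (B *\<^sub>v z) = d + vec_degree z"
    and R: "R \<in> carrier_mat q p" "minimal_basis_of q W (cols R)"
  shows "minimal_basis_of q' W' (cols (A * R))"
proof -
  have A': "A' \<in> carrier_mat q' q" and B': "B' \<in> carrier_mat q q'"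
    using A B by (auto simp: A'_def B'_def)
  have cb_R: "column_basis W (map_mat to_fract R)"
    using R poly_basis_cols_iff[OF R(1) W] unfolding minimal_basis_of_def by simp
  have AR: "A * R \<in> carrier_mat q' p" using A R by simp
  have cb_AR: "column_basis W' (map_mat to_fract (A * R))"
    using column_basis_transfer[OF cb_R _ A' B' AW BA BW AB] R
    by (simp add: to_fract.mat_hom_mult[OF A R(1)] A'_def)
  have degrees: "sum_list (map vec_degree (cols (B * S))) = s * d + sum_list (map vec_degree (cols S))"
    if S: "S \<in> carrier_mat q' s" "column_basis W' (map_mat to_fract S)" for S s
  proof -
    have "map vec_degree (cols (B * S)) = map (\<lambda>v. d + vec_degree v) (cols S)"
    proof (rule nth_equalityI)
      show "length (map vec_degree (cols (B * S))) = length (map (\<lambda>v. d + vec_degree v) (cols S))"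
        using S by simp
      fix j assume "j < length (map vec_degree (cols (B * S)))"
      then have j: "j < s" using S by simp
      have "vec_degree (B *\<^sub>v col S j) = d + vec_degree (col S j)"
        using column_basis_col[OF S(2,1) j] S j by (intro deg) auto
      moreover have "col (B * S) j = B *\<^sub>v col S j"
        using B S j by (intro eq_vecI) auto
      ultimately show "map vec_degree (cols (B * S)) ! j = map (\<lambda>v. d + vec_degree v) (cols S) ! j"
        using S j by simp
    qed
    then show ?thesis using S by (simp add: sum_list_addf sum_list_replicate map_replicate_const)
  qed
  \<comment> \<open>The inverse relation is given over the fraction field and descends by injectivity of \<open>to_fract\<close>.\<close>
  have BAR: "B * (A * R) = R"
  proof (rule eq_matI)
    fix i j assume ij: "i < dim_row R" "j < dim_col R"
    then have j: "j < p" using R by simp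
    have col: "col R j \<in> carrier_vec q" using R j by auto
    have "col (B * (A * R)) j = B *\<^sub>v (A *\<^sub>v col R j)"
      unfolding col_mult2[OF B AR j] col_mult2[OF A R(1) j] ..
    then have "map_vec to_fract (col (B * (A * R)) j) = B' *\<^sub>v (A' *\<^sub>v map_vec to_fract (col R j))"
      unfolding A'_def B'_def
      using to_fract.mult_mat_vec_hom[OF B mult_mat_vec_carrier[OF A col]]
        to_fract.mult_mat_vec_hom[OF A col] by simp
    also have "\<dots> = map_vec to_fract (col R j)"
      using BA[OF column_basis_col(1)[OF cb_R R(1) j]] .
    finally have "col (B * (A * R)) j = col R j" by (rule to_fract.vec_hom_inj)
    then have "col (B * (A * R)) j $ i = col R j $ i" by simp
    then show "(B * (A * R)) $$ (i, j) = R $$ (i, j)"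
      using ij A B R by simp
  qed (use A B R in auto)
  show ?thesis
    unfolding minimal_basis_of_def
  proof (intro conjI allI impI)
    show pb: "poly_basis q' W' (cols (A * R))"
      using poly_basis_cols_iff[OF AR W'] cb_AR by simp
    fix ws assume ws: "poly_basis q' W' ws"
    define S where "S = mat_of_cols q' ws"
    have S: "S \<in> carrier_mat q' (length ws)" "cols S = ws"
      using poly_basis_as_cols[OF ws] by (auto simp: S_def)
    have len: "length ws = p"
      using poly_basis_length_eq[OF W' ws pb] R by simp
    have cb_S: "column_basis W' (map_mat to_fract S)"
      using ws poly_basis_cols_iff[OF S(1) W'] S(2) by simp
    have "column_basis W (map_mat to_fract (B * S))"
      using column_basis_transfer[OF cb_S _ B' A' BW AB AW BA] S
      by (simp add: to_fract.mat_hom_mult[OF B S(1)] B'_def)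
    then have "poly_basis q W (cols (B * S))"
      using poly_basis_cols_iff[of "B * S" q "length ws" W] W B S by simp
    then have "sum_list (map vec_degree (cols R)) \<le> sum_list (map vec_degree (cols (B * S)))"
      using R unfolding minimal_basis_of_def by simp
    then show "sum_list (map vec_degree (cols (A * R))) \<le> sum_list (map vec_degree ws)"
      using degrees[OF AR cb_AR] degrees[OF S(1) cb_S] S(2) len BAR by simp
  qed
qed

section \<open>Minimal bases whose elements have equal degrees\<close>

lemma mat_kernel_submodule:
  fixes A :: "'k :: field mat"
  assumes A: "A \<in> carrier_mat nr nc"
  shows "submodule class_ring (mat_kernel A) (module_vec TYPE('k) nc)"
proof -
  interpret vec_space "TYPE('k)" nc .
  show ?thesis
    using A mult_add_distrib_mat_vec[OF A] mult_mat_vec[OF A] mat_kernel[OF A]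
    by unfold_locales (auto simp: class_ring_simps)
qed

lemma row_space_as_image:
  fixes N :: "'k :: field mat"
  assumes "N \<in> carrier_mat p q"
  shows "vec_space.row_space q N = (\<lambda>c. transpose_mat N *\<^sub>v c) ` carrier_vec p"
  using vec_space.row_space_eq[OF assms] assms by auto

lemma row_space_submodule:
  fixes N :: "'k :: field mat"
  assumes "N \<in> carrier_mat p q"
  shows "submodule class_ring (vec_space.row_space q N) (module_vec TYPE('k) q)"
proof -
  interpret vec_space "TYPE('k)" q .
  show ?thesis
    unfolding row_space_def using assms by (intro span_is_submodule) (auto simp: rows_carrier set_rows_carrier)
qed

text \<open>
  Exchange of one basis vector. The new matrix \<open>Y\<close> is \<open>X\<close> times the identity matrix with column \<open>j\<close>
  replaced by \<open>c\<close>; in coordinates, \<open>Y a = X (a - a\<^sub>j e\<^sub>j + a\<^sub>j c)\<close>, and the change of coordinates is invertible because \<open>c\<^sub>j \<noteq> 0\<close>.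
\<close>

lemma column_basis_replace:
  fixes X :: "'k :: field mat"
  assumes X: "column_basis W X" "X \<in> carrier_mat q p" and j: "j < p"
    and c: "c \<in> carrier_vec p" "c $ j \<noteq> 0"
  defines "Y \<equiv> mat q p (\<lambda>(i, k). if k = j then (X *\<^sub>v c) $ i else X $$ (i, k))"
  shows "column_basis W Y"
proof (rule column_basisI)
  define E where "E a = vec p (\<lambda>k. (if k = j then 0 else a $ k) + a $ j * c $ k)" for a :: "'k vec"
  have E: "E a \<in> carrier_vec p" for a by (simp add: E_def)
  have YE: "Y *\<^sub>v a = X *\<^sub>v E a" if a: "a \<in> carrier_vec p" for a
  proof (rule eq_vecI)
    fix i assume "i < dim_vec (X *\<^sub>v E a)"
    then have i: "i < q" using X by simp
    have "(Y *\<^sub>v a) $ i = (\<Sum>k<p. if k = j then (X *\<^sub>v c) $ i * a $ j else X $$ (i, k) * a $ k)"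
      using a i X by (auto simp: Y_def scalar_prod_def lessThan_atLeast0 intro!: sum.cong)
    also have "\<dots> = (X *\<^sub>v c) $ i * a $ j + (\<Sum>k\<in>{..<p} - {j}. X $$ (i, k) * a $ k)"
      using j by (simp add: sum.remove[of _ j])
    also have "(\<Sum>k\<in>{..<p} - {j}. X $$ (i, k) * a $ k) =
        (\<Sum>k<p. X $$ (i, k) * (if k = j then 0 else a $ k))"
      using j by (simp add: sum.remove[of _ j])
    also have "(X *\<^sub>v c) $ i * a $ j = (\<Sum>k<p. X $$ (i, k) * (a $ j * c $ k))"
      using c i X by (auto simp: scalar_prod_def lessThan_atLeast0 sum_distrib_left mult_ac intro!: sum.cong)
    also have "\<dots> + (\<Sum>k<p. X $$ (i, k) * (if k = j then 0 else a $ k)) =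
        (\<Sum>k<p. X $$ (i, k) * E a $ k)"
      by (simp add: E_def distrib_left sum.distrib)
    also have "\<dots> = (X *\<^sub>v E a) $ i"
      using i X E[of a] by (simp add: scalar_prod_def lessThan_atLeast0)
    finally show "(Y *\<^sub>v a) $ i = (X *\<^sub>v E a) $ i" .
  qed (use X in \<open>simp add: Y_def\<close>)
  show "Y \<in> carrier_mat q p" by (simp add: Y_def)
  show "Y *\<^sub>v a \<in> W" if "a \<in> carrier_vec p" for a
    using YE[OF that] column_basisD(1)[OF X E] by simp
  show "\<exists>a \<in> carrier_vec p. w = Y *\<^sub>v a" if w: "w \<in> W" for w
  proof -
    obtain b where b: "b \<in> carrier_vec p" "w = X *\<^sub>v b"
      using column_basisD(2)[OF X w] by blast
    \<comment> \<open>The solution of \<open>E a = b\<close>: component \<open>j\<close> determines \<open>a $ j\<close>, and the others follow.\<close>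
    define a where "a = vec p (\<lambda>k. if k = j then b $ j / c $ j else b $ k - b $ j / c $ j * c $ k)"
    have "E a = b" using b c j by (intro eq_vecI) (auto simp: E_def a_def)
    moreover have "a \<in> carrier_vec p" by (simp add: a_def)
    ultimately show ?thesis using YE b by metis
  qed
  show "a = 0\<^sub>v p" if a: "a \<in> carrier_vec p" "Y *\<^sub>v a = 0\<^sub>v q" for a
  proof -
    have "E a = 0\<^sub>v p" using column_basisD(3)[OF X E] YE a by simp
    then have *: "E a $ k = 0" if "k < p" for k using that by simp
    have "a $ j = 0" using *[OF j] j c by (simp add: E_def)
    then have "a $ k = 0" if "k < p" for k
      using *[OF that] that by (cases "k = j") (auto simp: E_def)
    then show ?thesis using a by (intro eq_vecI) auto
  qed
qed

text \<open>
  A nonzero vector polynomial of degree less than \<open>d\<close> could be exchanged for some basis vector, which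
  has degree \<open>d\<close>, and this would decrease the degree sum.
\<close>

lemma minimal_basis_degree_lower_bound:
  fixes W :: "'a :: field poly fract vec set"
  assumes W: "submodule class_ring W (module_vec TYPE('a poly fract) q)"
    and R: "R \<in> carrier_mat q p" "minimal_basis_of q W (cols R)"
    and deg: "\<And>j. j < p \<Longrightarrow> vec_degree (col R j) = d"
    and v: "v \<in> carrier_vec q" "v \<noteq> 0\<^sub>v q" "map_vec to_fract v \<in> W"
  shows "d \<le> vec_degree v"
proof -
  have R': "map_mat to_fract R \<in> carrier_mat q p" using R by simp
  have cb: "column_basis W (map_mat to_fract R)"
    using R poly_basis_cols_iff[OF R(1) W] unfolding minimal_basis_of_def by simp
  obtain c where c: "c \<in> carrier_vec p" "map_vec to_fract v = map_mat to_fract R *\<^sub>v c"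
    using column_basisD(2)[OF cb R' v(3)] by blast
  have "c \<noteq> 0\<^sub>v p"
  proof
    assume "c = 0\<^sub>v p"
    then have "map_vec to_fract v = map_vec to_fract (0\<^sub>v q)"
      using c R by (intro eq_vecI) auto
    then show False using v(2) to_fract.vec_hom_inj by blast
  qed
  then obtain j where j: "j < p" "c $ j \<noteq> 0"
    using c by (metis carrier_vecD eq_vecI index_zero_vec)
  define S where "S = mat q p (\<lambda>(i, k). if k = j then v $ i else R $$ (i, k))"
  have S: "S \<in> carrier_mat q p" by (simp add: S_def)
  have "map_mat to_fract S = mat q p (\<lambda>(i, k). if k = j then (map_mat to_fract R *\<^sub>v c) $ i
      else map_mat to_fract R $$ (i, k))"
    using v(1) R unfolding c(2)[symmetric] by (intro eq_matI) (auto simp: S_def)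
  then have "column_basis W (map_mat to_fract S)"
    using column_basis_replace[OF cb R' j(1) c(1) j(2)] by simp
  then have "poly_basis q W (cols S)" using poly_basis_cols_iff[OF S W] by simp
  then have le: "sum_list (map vec_degree (cols R)) \<le> sum_list (map vec_degree (cols S))"
    using R unfolding minimal_basis_of_def by simp
  have "cols S ! k = (if k = j then v else col R k)" if "k < p" for k
    using that v R by (intro eq_vecI) (auto simp: S_def)
  then have "map vec_degree (cols S) = (replicate p d)[j := vec_degree v]"
    using S deg by (intro nth_equalityI) (auto simp: nth_list_update)
  moreover have "map vec_degree (cols R) = replicate p d"
    using R deg by (intro nth_equalityI) auto
  ultimately have "p * d \<le> p * d + vec_degree v - d"
    using le j by (simp add: sum_list_update sum_list_replicate)
  moreover have "d \<le> p * d" using j by simp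
  ultimately show ?thesis by linarith
qed

lemma minimal_basis_iff:
  fixes N :: "'a :: field poly mat"
  assumes "N \<in> carrier_mat p q"
  shows "minimal_basis N \<longleftrightarrow> p < q \<and>
    minimal_basis_of q (vec_space.row_space q (map_mat to_fract N)) (cols (transpose_mat N))"
  using assms unfolding minimal_basis_def by simp

lemma row_space_image_transpose:
  fixes N :: "'a :: field poly mat"
  assumes N: "N \<in> carrier_mat p q" and c: "c \<in> carrier_vec p"
  shows "map_vec to_fract (transpose_mat N *\<^sub>v c) \<in> vec_space.row_space q (map_mat to_fract N)"
proof -
  have "map_vec to_fract (transpose_mat N *\<^sub>v c) =
      transpose_mat (map_mat to_fract N) *\<^sub>v map_vec to_fract c"
    using N c to_fract.mult_mat_vec_hom[of "transpose_mat N" q p c]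
    by (simp add: map_mat_transpose)
  then show ?thesis
    using row_space_as_image[of "map_mat to_fract N" p q] N c by auto
qed

lemma minimal_basis_column_basis:
  fixes N :: "'a :: field poly mat"
  assumes N: "N \<in> carrier_mat p q" "minimal_basis N"
  shows "column_basis (vec_space.row_space q (map_mat to_fract N)) (map_mat to_fract (transpose_mat N))"
proof -
  have "submodule class_ring (vec_space.row_space q (map_mat to_fract N)) (module_vec TYPE('a poly fract) q)"
    using N by (intro row_space_submodule) simp
  then show ?thesis
    using N poly_basis_cols_iff[of "transpose_mat N" q p] minimal_basis_iff[OF N(1)]
    unfolding minimal_basis_of_def by simp
qed

lemma minimal_basis_transpose_inj:
  fixes N :: "'a :: field poly mat"
  assumes N: "N \<in> carrier_mat p q" "minimal_basis N"
    and c: "c \<in> carrier_vec p" "c \<noteq> 0\<^sub>v p"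
  shows "transpose_mat N *\<^sub>v c \<noteq> 0\<^sub>v q"
proof
  assume "transpose_mat N *\<^sub>v c = 0\<^sub>v q"
  then have zero: "map_mat to_fract (transpose_mat N) *\<^sub>v map_vec to_fract c = 0\<^sub>v q"
    using N c to_fract.mult_mat_vec_hom[of "transpose_mat N" q p c]
    by (simp add: to_fract.vec_hom_zero)
  have Nt: "map_mat to_fract (transpose_mat N) \<in> carrier_mat q p" using N by simp
  have "map_vec to_fract c \<in> carrier_vec p" using c by simp
  then have "map_vec to_fract c = 0\<^sub>v p"
    using column_basisD(3)[OF minimal_basis_column_basis[OF N] Nt _ zero] by blast
  then show False using c(2) to_fract.vec_hom_inj[of c "0\<^sub>v p"] by (simp add: to_fract.vec_hom_zero)
qed

text \<open>
  The lower bound above is exactly what the predictable degree property requires, as the vectors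
  \<open>N\<^sup>T c\<close> lie in the row space.
\<close>

lemma minimal_basis_shifts_degree:
  fixes N :: "'a :: field poly mat"
  assumes N: "N \<in> carrier_mat p q" "minimal_basis N"
    and deg: "\<forall>e \<in> set (row_degrees N). e = d"
  shows "shifts_degree d (transpose_mat N)"
proof -
  have sub: "submodule class_ring (vec_space.row_space q (map_mat to_fract N)) (module_vec TYPE('a poly fract) q)"
    using N by (intro row_space_submodule) simp
  have deg': "vec_degree (row N j) = d" if "j < p" for j
    using deg that N unfolding row_degrees_def by (auto simp: rows_def)
  show ?thesis
  proof (rule shifts_degreeI)
    show Nt: "transpose_mat N \<in> carrier_mat q p" using N by simp
    show "has_grade d (transpose_mat N)"
      unfolding has_grade_def
    proof (intro allI impI)
      fix i j assume "i < dim_row (transpose_mat N)" "j < dim_col (transpose_mat N)"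
      then show "degree (transpose_mat N $$ (i, j)) \<le> d"
        using degree_le_vec_degree[of i "row N j"] deg' N by simp
    qed
    fix c :: "'a poly vec" assume c: "c \<in> carrier_vec p" "c \<noteq> 0\<^sub>v p"
    show nz: "transpose_mat N *\<^sub>v c \<noteq> 0\<^sub>v q" using minimal_basis_transpose_inj[OF N c] .
    show "d \<le> vec_degree (transpose_mat N *\<^sub>v c)"
      using minimal_basis_degree_lower_bound[OF sub Nt, of d "transpose_mat N *\<^sub>v c"]
        minimal_basis_iff[OF N(1)] N deg' nz row_space_image_transpose[OF N(1) c(1)]
        mult_mat_vec_carrier[OF Nt c(1)]
      by simp
  qed
qed

text \<open>
  The injectivity of \<open>N'\<^sup>T\<close> passes to the square matrix \<open>C\<close>, which is therefore invertible.
\<close>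

lemma row_space_eqI:
  fixes N N' :: "'k :: field mat"
  assumes N: "N \<in> carrier_mat p q" and N': "N' \<in> carrier_mat p q" and C: "C \<in> carrier_mat p p"
    and NC: "transpose_mat N' = transpose_mat N * C"
    and inj: "\<And>c. c \<in> carrier_vec p \<Longrightarrow> transpose_mat N' *\<^sub>v c = 0\<^sub>v q \<Longrightarrow> c = 0\<^sub>v p"
  shows "vec_space.row_space q N' = vec_space.row_space q N"
proof -
  have Nt: "transpose_mat N \<in> carrier_mat q p" using N by simp
  have "det C \<noteq> 0"
  proof
    assume "det C = 0"
    then obtain v where v: "v \<in> carrier_vec p" "v \<noteq> 0\<^sub>v p" "C *\<^sub>v v = 0\<^sub>v p"
      using det_0_iff_vec_prod_zero_field[OF C] by blast
    have "transpose_mat N' *\<^sub>v v = transpose_mat N *\<^sub>v (C *\<^sub>v v)"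
      unfolding NC using Nt C v by simp
    also have "\<dots> = 0\<^sub>v q" unfolding v(3) using Nt by (intro eq_vecI) auto
    finally show False using inj v by blast
  qed
  then obtain D where D: "D \<in> carrier_mat p p" "C * D = 1\<^sub>m p"
    using det_non_zero_imp_unit[OF C, of "()"] unfolding Units_def ring_mat_def by auto
  have "(\<lambda>c. transpose_mat N' *\<^sub>v c) ` carrier_vec p = (\<lambda>c. transpose_mat N *\<^sub>v c) ` carrier_vec p"
  proof (intro equalityI image_subsetI)
    fix c :: "'k vec" assume c: "c \<in> carrier_vec p"
    have "transpose_mat N' *\<^sub>v c = transpose_mat N *\<^sub>v (C *\<^sub>v c)"
      unfolding NC using Nt C c by simp
    then show "transpose_mat N' *\<^sub>v c \<in> (\<lambda>c. transpose_mat N *\<^sub>v c) ` carrier_vec p"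
      using C c by auto
    have "transpose_mat N *\<^sub>v c = transpose_mat N *\<^sub>v (C * D *\<^sub>v c)"
      using D c by simp
    also have "\<dots> = transpose_mat N *\<^sub>v (C *\<^sub>v (D *\<^sub>v c))"
      using assoc_mult_mat_vec[OF C D(1) c] by simp
    also have "\<dots> = transpose_mat N' *\<^sub>v (D *\<^sub>v c)"
      unfolding NC using assoc_mult_mat_vec[OF Nt C mult_mat_vec_carrier[OF D(1) c]] by simp
    finally show "transpose_mat N *\<^sub>v c \<in> (\<lambda>c. transpose_mat N' *\<^sub>v c) ` carrier_vec p"
      using D c by auto
  qed
  then show ?thesis using row_space_as_image[OF N] row_space_as_image[OF N'] by simp
qed

section \<open>Dual minimal bases and unimodular completions\<close>

text \<open>
  The definition of a strong block matrix only provides some dual minimal basis \<open>N'\<close> with equal row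
  degrees \<open>d\<close>, whereas \<open>N\<close> is arbitrary. From \<open>K N'\<^sup>T = 0\<close> and the completion, \<open>N'\<^sup>T = N\<^sup>T (Khat N'\<^sup>T)\<close>, so
  \<open>N\<close> and \<open>N'\<close> are minimal bases of the same space and have the same degree sum. By the
  exchange argument for \<open>N'\<close> every row of \<open>N\<close> has degree at least \<open>d\<close>, so all these degrees are
  equal to \<open>d\<close>.
\<close>

lemma dual_minimal_basis_shifts_degree:
  fixes K N Khat Nhat :: "'a :: field poly mat"
  assumes K: "K \<in> carrier_mat k q" and N: "N \<in> carrier_mat p q"
    and Khat: "Khat \<in> carrier_mat p q" and Nhat: "Nhat \<in> carrier_mat k q"
    and block: "minimal_basis_block l K" and dual: "dual_minimal_bases K N"
    and inv: "transpose_mat Nhat * K + transpose_mat N * Khat = 1\<^sub>m q"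
  shows "\<exists>d. shifts_degree d (transpose_mat N)"
proof -
  obtain N' d where dual': "dual_minimal_bases K N'"
    and deg': "\<forall>e \<in> set (row_degrees N'). e = d"
    using block unfolding minimal_basis_block_def by blast
  have N': "N' \<in> carrier_mat p q"
    using dual dual' K N unfolding dual_minimal_bases_def by auto
  have mN: "minimal_basis N" and mN': "minimal_basis N'"
    using dual dual' unfolding dual_minimal_bases_def by auto
  define C where "C = Khat * transpose_mat N'"
  have C: "C \<in> carrier_mat p p" using Khat N' by (simp add: C_def)
  have "transpose_mat N' = (transpose_mat Nhat * K + transpose_mat N * Khat) * transpose_mat N'"
    using inv N' by simp
  also have "\<dots> = transpose_mat Nhat * (K * transpose_mat N') + transpose_mat N * C"
    using K N Khat Nhat N'
    by (simp add: C_def add_mult_distrib_mat[of _ q q _ _ p] assoc_mult_mat[of _ q k _ q _ p]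
        assoc_mult_mat[of _ q p _ q _ p])
  also have "K * transpose_mat N' = 0\<^sub>m k p"
    using dual' K N' unfolding dual_minimal_bases_def by simp
  also have "transpose_mat Nhat * 0\<^sub>m k p + transpose_mat N * C = transpose_mat N * C"
    using Nhat N C by simp
  finally have N'C: "transpose_mat N' = transpose_mat N * C" .
  define W where "W = vec_space.row_space q (map_mat to_fract N)"
  have spaces: "vec_space.row_space q (map_mat to_fract N') = W"
    unfolding W_def
  proof (rule row_space_eqI)
    show "transpose_mat (map_mat to_fract N') = transpose_mat (map_mat to_fract N) * map_mat to_fract C"
      using to_fract.mat_hom_mult[of "transpose_mat N" q p C p] N'C N C
      by (simp add: map_mat_transpose)
    show "c = 0\<^sub>v p" if "c \<in> carrier_vec p" "transpose_mat (map_mat to_fract N') *\<^sub>v c = 0\<^sub>v q" for c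
      using column_basisD(3)[OF minimal_basis_column_basis[OF N' mN'] _ that(1)] that N'
      by (simp add: map_mat_transpose)
  qed (use N N' C in auto)
  have sub: "submodule class_ring W (module_vec TYPE('a poly fract) q)"
    unfolding W_def using N by (intro row_space_submodule) simp
  have min: "minimal_basis_of q W (cols (transpose_mat N))"
    using mN minimal_basis_iff[OF N] by (simp add: W_def)
  have min': "minimal_basis_of q W (cols (transpose_mat N'))"
    using mN' minimal_basis_iff[OF N'] by (simp add: spaces)
  have d': "vec_degree (row N' j) = d" if "j < p" for j
    using deg' that N' unfolding row_degrees_def by (auto simp: rows_def)
  \<comment> \<open>Exchange in \<open>N'\<close>, whose rows are known to have equal degrees.\<close>
  have ge: "d \<le> vec_degree v" if "v \<in> carrier_vec q" "v \<noteq> 0\<^sub>v q" "map_vec to_fract v \<in> W" for v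
    using minimal_basis_degree_lower_bound[OF sub _ min' _ that, of p d] N' d' by simp
  have image: "map_vec to_fract (transpose_mat N *\<^sub>v c) \<in> W" if "c \<in> carrier_vec p" for c
    using row_space_image_transpose[OF N that] by (simp add: W_def)
  have row_ge: "d \<le> vec_degree (row N j)" if j: "j < p" for j
  proof (rule ge)
    have row: "row N j = transpose_mat N *\<^sub>v unit_vec p j"
      using col_eq_mult_unit_vec[of "map_mat to_fract (transpose_mat N)" q p j] N j
      by (intro eq_vecI) auto
    show "map_vec to_fract (row N j) \<in> W" unfolding row by (rule image) simp
    show "row N j \<noteq> 0\<^sub>v q"
      unfolding row using minimal_basis_transpose_inj[OF N mN] j by simp
    show "row N j \<in> carrier_vec q" using N j by auto
  qed
  have "sum_list (map vec_degree (cols (transpose_mat N))) \<le>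
      sum_list (map vec_degree (cols (transpose_mat N')))"
    using min min' unfolding minimal_basis_of_def by blast
  moreover have "sum_list (map vec_degree (cols (transpose_mat X))) = (\<Sum>j<p. vec_degree (row X j))"
    if "X \<in> carrier_mat p q" for X :: "'a poly mat"
    using that by (simp add: sum_list_sum_nth lessThan_atLeast0)
  ultimately have sum_le: "(\<Sum>j<p. vec_degree (row N j)) \<le> (\<Sum>j<p. d)"
    using N N' d' by simp
  have "vec_degree (row N j) = d" if j: "j < p" for j
  proof (rule ccontr)
    assume "vec_degree (row N j) \<noteq> d"
    then have "d < vec_degree (row N j)" using row_ge[OF j] by simp
    then have "(\<Sum>j<p. d) < (\<Sum>j<p. vec_degree (row N j))"
      using row_ge j by (intro sum_strict_mono_ex1) auto
    then show False using sum_le by simp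
  qed
  then have "\<forall>e \<in> set (row_degrees N). e = d"
    using N unfolding row_degrees_def by (auto simp: rows_def)
  then show ?thesis using minimal_basis_shifts_degree[OF N mN] by blast
qed

lemma shifts_degree_one: "shifts_degree 0 (1\<^sub>m q)"
  unfolding shifts_degree_def by simp

text \<open>
  The blocks of \<open>U V = I\<close> and \<open>V U = I\<close>.
\<close>

lemma completion_identities:
  fixes K N Khat Nhat :: "'a :: field poly mat"
  assumes comp: "dual_unimodular_completion K N Khat Nhat" and K: "K \<in> carrier_mat k q"
    and N: "N \<in> carrier_mat p q"
  shows "K * transpose_mat Nhat = 1\<^sub>m k" "K * transpose_mat N = 0\<^sub>m k p"
    "Khat * transpose_mat N = 1\<^sub>m p"
    "transpose_mat Nhat * K + transpose_mat N * Khat = 1\<^sub>m q"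
proof -
  let ?U = "K @\<^sub>r Khat" and ?V = "transpose_mat Nhat @\<^sub>c transpose_mat N"
  have Khat: "Khat \<in> carrier_mat p q" and Nhat: "Nhat \<in> carrier_mat k q"
    and U: "unimodular ?U" and UV: "inverts_mat ?U ?V" and VU: "inverts_mat ?V ?U"
    using comp K N unfolding dual_unimodular_completion_def by (auto simp: Let_def)
  have kp: "k + p = q" using U K Khat unfolding unimodular_def append_rows_def by simp
  have UVm: "?U * ?V = four_block_mat (K * transpose_mat Nhat) (K * transpose_mat N)
      (Khat * transpose_mat Nhat) (Khat * transpose_mat N)"
    unfolding append_rows_def append_cols_def
    using K N Khat Nhat by (subst mult_four_block_mat[of _ k q _ 0 _ p _ _ k _ p]) auto
  have one: "?U * ?V = 1\<^sub>m (k + p)"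
    using UV K Khat unfolding inverts_mat_def append_rows_def by simp
  have entry: "four_block_mat (K * transpose_mat Nhat) (K * transpose_mat N)
      (Khat * transpose_mat Nhat) (Khat * transpose_mat N) $$ (i, j) = 1\<^sub>m (k + p) $$ (i, j)" for i j
    using UVm one by simp
  show "K * transpose_mat Nhat = 1\<^sub>m k"
  proof (rule eq_matI)
    fix i j assume "i < dim_row (1\<^sub>m k :: 'a poly mat)" "j < dim_col (1\<^sub>m k :: 'a poly mat)"
    then show "(K * transpose_mat Nhat) $$ (i, j) = 1\<^sub>m k $$ (i, j)"
      using entry[of i j] K Khat N Nhat by simp
  qed (use K Nhat in auto)
  show "K * transpose_mat N = 0\<^sub>m k p"
  proof (rule eq_matI)
    fix i j assume "i < dim_row (0\<^sub>m k p :: 'a poly mat)" "j < dim_col (0\<^sub>m k p :: 'a poly mat)"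
    then show "(K * transpose_mat N) $$ (i, j) = 0\<^sub>m k p $$ (i, j)"
      using entry[of i "k + j"] K Khat N Nhat by simp
  qed (use K N in auto)
  show "Khat * transpose_mat N = 1\<^sub>m p"
  proof (rule eq_matI)
    fix i j assume "i < dim_row (1\<^sub>m p :: 'a poly mat)" "j < dim_col (1\<^sub>m p :: 'a poly mat)"
    then show "(Khat * transpose_mat N) $$ (i, j) = 1\<^sub>m p $$ (i, j)"
      using entry[of "k + i" "k + j"] K Khat N Nhat by simp
  qed (use Khat N in auto)
  have "?V * ?U = four_block_mat (transpose_mat Nhat * K + transpose_mat N * Khat)
      (0\<^sub>m q 0) (0\<^sub>m 0 q) (0\<^sub>m 0 0)"
    unfolding append_rows_def append_cols_def
    using K N Khat Nhat by (subst mult_four_block_mat[of _ q k _ p _ 0 _ _ q _ 0]) auto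
  also have "\<dots> = transpose_mat Nhat * K + transpose_mat N * Khat"
    using K N Khat Nhat by (intro eq_matI) auto
  finally show "transpose_mat Nhat * K + transpose_mat N * Khat = 1\<^sub>m q"
    using VU Nhat unfolding inverts_mat_def append_cols_def by simp
qed

text \<open>
  The blockwise identities saying that the matrix with the block rows \<open>K\<close>, \<open>Khat\<close> and the one with
  the block columns \<open>Nhat\<^sup>T\<close>, \<open>N\<^sup>T\<close> are inverse to each other. As identities over a commutative ring
  they carry over from \<open>\<bbbF>[\<lambda>]\<close> to \<open>\<bbbF>(\<lambda>)\<close>; both versions are used, the first one to control degrees
  and the second one to describe the rational kernels.
\<close>

definition completed_pair :: "nat \<Rightarrow> nat \<Rightarrow> 'r :: comm_ring_1 mat \<Rightarrow> 'r mat \<Rightarrow> 'r mat \<Rightarrow> 'r mat \<Rightarrow> bool" where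
  "completed_pair k p K N Khat Nhat \<longleftrightarrow>
     K \<in> carrier_mat k (p + k) \<and> N \<in> carrier_mat p (p + k) \<and>
     Khat \<in> carrier_mat p (p + k) \<and> Nhat \<in> carrier_mat k (p + k) \<and>
     K * transpose_mat Nhat = 1\<^sub>m k \<and> K * transpose_mat N = 0\<^sub>m k p \<and>
     Khat * transpose_mat N = 1\<^sub>m p \<and>
     transpose_mat Nhat * K + transpose_mat N * Khat = 1\<^sub>m (p + k)"

lemma completed_pair_map_to_fract:
  fixes K N Khat Nhat :: "'a :: field poly mat"
  assumes "completed_pair k p K N Khat Nhat"
  shows "completed_pair k p (map_mat to_fract K) (map_mat to_fract N)
    (map_mat to_fract Khat) (map_mat to_fract Nhat)"
proof -
  let ?h = "map_mat (to_fract :: 'a poly \<Rightarrow> _)"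
  let ?q = "p + k"
  have K: "K \<in> carrier_mat k ?q" and N: "N \<in> carrier_mat p ?q"
    and Khat: "Khat \<in> carrier_mat p ?q" and Nhat: "Nhat \<in> carrier_mat k ?q"
    and eqs: "K * transpose_mat Nhat = 1\<^sub>m k" "K * transpose_mat N = 0\<^sub>m k p"
    "Khat * transpose_mat N = 1\<^sub>m p"
    "transpose_mat Nhat * K + transpose_mat N * Khat = 1\<^sub>m ?q"
    using assms unfolding completed_pair_def by auto
  have mult_transpose: "?h X * transpose_mat (?h Y) = ?h (X * transpose_mat Y)"
    if "X \<in> carrier_mat r ?q" "Y \<in> carrier_mat s ?q" for X Y r s
    using to_fract.mat_hom_mult[of X r ?q "transpose_mat Y" s] that by (simp add: map_mat_transpose)
  have transpose_mult: "transpose_mat (?h X) * ?h Y = ?h (transpose_mat X * Y)"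
    if "X \<in> carrier_mat r ?q" "Y \<in> carrier_mat r ?q" for X Y r
    using to_fract.mat_hom_mult[of "transpose_mat X" ?q r Y ?q] that by (simp add: map_mat_transpose)
  have zero: "?h (0\<^sub>m k p) = 0\<^sub>m k p" by (rule eq_matI) auto
  have "?h (transpose_mat Nhat * K) + ?h (transpose_mat N * Khat) = ?h (1\<^sub>m ?q)"
    unfolding eqs(4)[symmetric] using K N Khat Nhat by (intro eq_matI) auto
  then show ?thesis
    unfolding completed_pair_def
    using K N Khat Nhat eqs
    by (simp add: mult_transpose[OF K Nhat] mult_transpose[OF K N] mult_transpose[OF Khat N]
        transpose_mult[OF Nhat K] transpose_mult[OF N Khat] to_fract.mat_hom_one zero)
qed

lemma completed_pair_transpose:
  assumes "completed_pair k p K N Khat Nhat"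
  shows "Nhat * transpose_mat K = 1\<^sub>m k" "N * transpose_mat K = 0\<^sub>m p k"
    "transpose_mat K * Nhat + transpose_mat Khat * N = 1\<^sub>m (p + k)"
proof -
  let ?q = "p + k"
  have K: "K \<in> carrier_mat k ?q" and N: "N \<in> carrier_mat p ?q"
    and Khat: "Khat \<in> carrier_mat p ?q" and Nhat: "Nhat \<in> carrier_mat k ?q"
    and eqs: "K * transpose_mat Nhat = 1\<^sub>m k" "K * transpose_mat N = 0\<^sub>m k p"
    "transpose_mat Nhat * K + transpose_mat N * Khat = 1\<^sub>m ?q"
    using assms unfolding completed_pair_def by auto
  show "Nhat * transpose_mat K = 1\<^sub>m k"
    using arg_cong[OF eqs(1), of transpose_mat] transpose_mult[of K k ?q "transpose_mat Nhat" k] K Nhat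
    by simp
  show "N * transpose_mat K = 0\<^sub>m p k"
    using arg_cong[OF eqs(2), of transpose_mat] transpose_mult[of K k ?q "transpose_mat N" p] K N
    by simp
  show "transpose_mat K * Nhat + transpose_mat Khat * N = 1\<^sub>m ?q"
    using arg_cong[OF eqs(3), of transpose_mat] K N Khat Nhat
      transpose_add[of "transpose_mat Nhat * K" ?q ?q "transpose_mat N * Khat"]
      transpose_mult[of "transpose_mat Nhat" ?q k K ?q] transpose_mult[of "transpose_mat N" ?q p Khat ?q]
    by simp
qed

section \<open>The kernel of the block matrix\<close>

lemma append_zero_vec: "0\<^sub>v k @\<^sub>v 0\<^sub>v l = 0\<^sub>v (k + l)"
  by (intro eq_vecI) auto

text \<open>
  The isomorphism between the kernels of \<open>L\<close> and \<open>Q\<close>. If \<open>(x, y)\<close> is in the kernel of \<open>L\<close>, then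
  \<open>K\<^sub>1 x = 0\<close>, hence \<open>x = N\<^sub>1\<^sup>T z\<close> with \<open>z = Khat\<^sub>1 x\<close>; multiplying \<open>M x + K\<^sub>2\<^sup>T y = 0\<close> by \<open>N\<^sub>2\<close> gives
  \<open>Q z = 0\<close>, and multiplying it by \<open>Nhat\<^sub>2\<close> gives \<open>y = - Nhat\<^sub>2 M x\<close>. Conversely, \<open>Q z = 0\<close> puts
  \<open>M N\<^sub>1\<^sup>T z\<close> into the column space of \<open>K\<^sub>2\<^sup>T\<close>. So \<open>project\<close> maps the first kernel to the second, with inverse \<open>lift\<close>.
\<close>

locale completed_block_matrix =
  fixes m n m\<^sub>1 m\<^sub>2 :: nat
    and M K\<^sub>1 K\<^sub>2 N\<^sub>1 N\<^sub>2 Khat\<^sub>1 Khat\<^sub>2 Nhat\<^sub>1 Nhat\<^sub>2 :: "'r :: comm_ring_1 mat"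
  assumes M: "M \<in> carrier_mat (m + m\<^sub>2) (n + m\<^sub>1)"
    and pair\<^sub>1: "completed_pair m\<^sub>1 n K\<^sub>1 N\<^sub>1 Khat\<^sub>1 Nhat\<^sub>1"
    and pair\<^sub>2: "completed_pair m\<^sub>2 m K\<^sub>2 N\<^sub>2 Khat\<^sub>2 Nhat\<^sub>2"
begin

definition L :: "'r mat" where "L = block_matrix M K\<^sub>1 K\<^sub>2"
definition Q :: "'r mat" where "Q = N\<^sub>2 * M * transpose_mat N\<^sub>1"
definition project :: "'r mat" where "project = Khat\<^sub>1 @\<^sub>c 0\<^sub>m n m\<^sub>2"
definition lift :: "'r mat" where
  "lift = transpose_mat N\<^sub>1 @\<^sub>r (- (Nhat\<^sub>2 * M * transpose_mat N\<^sub>1))"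

lemma K\<^sub>1: "K\<^sub>1 \<in> carrier_mat m\<^sub>1 (n + m\<^sub>1)" and N\<^sub>1: "N\<^sub>1 \<in> carrier_mat n (n + m\<^sub>1)"
  and Khat\<^sub>1: "Khat\<^sub>1 \<in> carrier_mat n (n + m\<^sub>1)" and Nhat\<^sub>1: "Nhat\<^sub>1 \<in> carrier_mat m\<^sub>1 (n + m\<^sub>1)"
  using pair\<^sub>1 unfolding completed_pair_def by auto

lemma K\<^sub>2: "K\<^sub>2 \<in> carrier_mat m\<^sub>2 (m + m\<^sub>2)" and N\<^sub>2: "N\<^sub>2 \<in> carrier_mat m (m + m\<^sub>2)"
  and Khat\<^sub>2: "Khat\<^sub>2 \<in> carrier_mat m (m + m\<^sub>2)" and Nhat\<^sub>2: "Nhat\<^sub>2 \<in> carrier_mat m\<^sub>2 (m + m\<^sub>2)"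
  using pair\<^sub>2 unfolding completed_pair_def by auto

lemma L_carrier: "L \<in> carrier_mat (m + m\<^sub>2 + m\<^sub>1) (n + m\<^sub>1 + m\<^sub>2)"
  using M K\<^sub>1 K\<^sub>2 unfolding L_def block_matrix_def by auto

lemma Q_carrier: "Q \<in> carrier_mat m n"
  using M N\<^sub>1 N\<^sub>2 unfolding Q_def by simp

lemma project_carrier: "project \<in> carrier_mat n (n + m\<^sub>1 + m\<^sub>2)"
  using Khat\<^sub>1 unfolding project_def append_cols_def by auto

lemma lift_carrier: "lift \<in> carrier_mat (n + m\<^sub>1 + m\<^sub>2) n"
  using N\<^sub>1 Nhat\<^sub>2 M unfolding lift_def by auto

lemma L_mult:
  assumes "x \<in> carrier_vec (n + m\<^sub>1)" "y \<in> carrier_vec m\<^sub>2"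
  shows "L *\<^sub>v (x @\<^sub>v y) = (M *\<^sub>v x + transpose_mat K\<^sub>2 *\<^sub>v y) @\<^sub>v (K\<^sub>1 *\<^sub>v x)"
proof -
  have "0\<^sub>m m\<^sub>1 m\<^sub>2 *\<^sub>v y = 0\<^sub>v m\<^sub>1" using assms by (intro eq_vecI) auto
  moreover have "K\<^sub>1 *\<^sub>v x + 0\<^sub>v m\<^sub>1 = K\<^sub>1 *\<^sub>v x" using assms K\<^sub>1 by simp
  ultimately show ?thesis
    using four_block_mat_mult_vec[of M "m + m\<^sub>2" "n + m\<^sub>1" "transpose_mat K\<^sub>2" m\<^sub>2 K\<^sub>1 m\<^sub>1 "0\<^sub>m m\<^sub>1 m\<^sub>2" x y]
      assms M K\<^sub>1 K\<^sub>2
    unfolding L_def block_matrix_def by simp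
qed

lemma project_mult:
  assumes "x \<in> carrier_vec (n + m\<^sub>1)" "y \<in> carrier_vec m\<^sub>2"
  shows "project *\<^sub>v (x @\<^sub>v y) = Khat\<^sub>1 *\<^sub>v x"
proof (rule eq_vecI)
  fix i assume "i < dim_vec (Khat\<^sub>1 *\<^sub>v x)"
  then have i: "i < n" using Khat\<^sub>1 by simp
  have "row project i = row Khat\<^sub>1 i @\<^sub>v 0\<^sub>v m\<^sub>2"
    using i Khat\<^sub>1 unfolding project_def append_cols_def by (intro eq_vecI) auto
  then show "(project *\<^sub>v (x @\<^sub>v y)) $ i = (Khat\<^sub>1 *\<^sub>v x) $ i"
    using i project_carrier Khat\<^sub>1 assms by (simp add: scalar_prod_append[of _ "n + m\<^sub>1" _ m\<^sub>2])
qed (use project_carrier Khat\<^sub>1 in auto)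

lemma lift_mult:
  assumes z: "z \<in> carrier_vec n"
  shows "lift *\<^sub>v z = (transpose_mat N\<^sub>1 *\<^sub>v z) @\<^sub>v (- (Nhat\<^sub>2 *\<^sub>v (M *\<^sub>v (transpose_mat N\<^sub>1 *\<^sub>v z))))"
proof -
  have "Nhat\<^sub>2 * M * transpose_mat N\<^sub>1 *\<^sub>v z = Nhat\<^sub>2 *\<^sub>v (M *\<^sub>v (transpose_mat N\<^sub>1 *\<^sub>v z))"
    using N\<^sub>1 Nhat\<^sub>2 M z
    by (simp add: assoc_mult_mat_vec[of _ m\<^sub>2 "m + m\<^sub>2" _ n] assoc_mult_mat_vec[of _ "m + m\<^sub>2" "n + m\<^sub>1" _ n])
  moreover have "- (Nhat\<^sub>2 * M * transpose_mat N\<^sub>1) *\<^sub>v z = - (Nhat\<^sub>2 * M * transpose_mat N\<^sub>1 *\<^sub>v z)"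
    using N\<^sub>1 Nhat\<^sub>2 M z by (intro uminus_mult_mat_vec) simp
  ultimately show ?thesis
    unfolding lift_def
    using N\<^sub>1 Nhat\<^sub>2 M z by (subst mat_mult_append[of _ "n + m\<^sub>1" n _ m\<^sub>2]) auto
qed

lemma Q_mult:
  assumes "z \<in> carrier_vec n"
  shows "Q *\<^sub>v z = N\<^sub>2 *\<^sub>v (M *\<^sub>v (transpose_mat N\<^sub>1 *\<^sub>v z))"
  using assms N\<^sub>1 N\<^sub>2 M unfolding Q_def
  by (simp add: assoc_mult_mat_vec[of _ m "m + m\<^sub>2" _ n] assoc_mult_mat_vec[of _ "m + m\<^sub>2" "n + m\<^sub>1" _ n])

lemma project_lift:
  assumes z: "z \<in> carrier_vec n"
  shows "project *\<^sub>v (lift *\<^sub>v z) = z"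
proof -
  have "project *\<^sub>v (lift *\<^sub>v z) = Khat\<^sub>1 *\<^sub>v (transpose_mat N\<^sub>1 *\<^sub>v z)"
    unfolding lift_mult[OF z] using z N\<^sub>1 Nhat\<^sub>2 M by (intro project_mult) auto
  also have "\<dots> = (Khat\<^sub>1 * transpose_mat N\<^sub>1) *\<^sub>v z"
    using z N\<^sub>1 Khat\<^sub>1 by simp
  also have "\<dots> = z" using pair\<^sub>1 z unfolding completed_pair_def by simp
  finally show ?thesis .
qed

lemma completed_split\<^sub>2:
  assumes w: "w \<in> carrier_vec (m + m\<^sub>2)"
  shows "w = transpose_mat K\<^sub>2 *\<^sub>v (Nhat\<^sub>2 *\<^sub>v w) + transpose_mat Khat\<^sub>2 *\<^sub>v (N\<^sub>2 *\<^sub>v w)"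
proof -
  have "w = (transpose_mat K\<^sub>2 * Nhat\<^sub>2 + transpose_mat Khat\<^sub>2 * N\<^sub>2) *\<^sub>v w"
    using completed_pair_transpose(3)[OF pair\<^sub>2] w by simp
  also have "\<dots> = transpose_mat K\<^sub>2 *\<^sub>v (Nhat\<^sub>2 *\<^sub>v w) + transpose_mat Khat\<^sub>2 *\<^sub>v (N\<^sub>2 *\<^sub>v w)"
    using K\<^sub>2 N\<^sub>2 Khat\<^sub>2 Nhat\<^sub>2 w by (simp add: add_mult_distrib_mat_vec[of _ "m + m\<^sub>2" "m + m\<^sub>2"])
  finally show ?thesis .
qed

lemma L_lift:
  assumes z: "z \<in> carrier_vec n" and Qz: "Q *\<^sub>v z = 0\<^sub>v m"
  shows "L *\<^sub>v (lift *\<^sub>v z) = 0\<^sub>v (m + m\<^sub>2 + m\<^sub>1)"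
proof -
  let ?x = "transpose_mat N\<^sub>1 *\<^sub>v z"
  let ?w = "M *\<^sub>v ?x"
  have x: "?x \<in> carrier_vec (n + m\<^sub>1)" using z N\<^sub>1 by simp
  have w: "?w \<in> carrier_vec (m + m\<^sub>2)" using x M by simp
  have "transpose_mat Khat\<^sub>2 *\<^sub>v 0\<^sub>v m = 0\<^sub>v (m + m\<^sub>2)"
    using Khat\<^sub>2 by (intro eq_vecI) auto
  then have "?w = transpose_mat K\<^sub>2 *\<^sub>v (Nhat\<^sub>2 *\<^sub>v ?w)"
    using completed_split\<^sub>2[OF w] Qz Q_mult[OF z] w K\<^sub>2 Nhat\<^sub>2 by simp
  moreover have "transpose_mat K\<^sub>2 *\<^sub>v (- (Nhat\<^sub>2 *\<^sub>v ?w)) = - (transpose_mat K\<^sub>2 *\<^sub>v (Nhat\<^sub>2 *\<^sub>v ?w))"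
    using K\<^sub>2 Nhat\<^sub>2 w by (intro eq_vecI) (auto simp: scalar_prod_uminus_right)
  ultimately have "?w + transpose_mat K\<^sub>2 *\<^sub>v (- (Nhat\<^sub>2 *\<^sub>v ?w)) = 0\<^sub>v (m + m\<^sub>2)"
    using w by (metis uminus_r_inv_vec)
  moreover have "K\<^sub>1 *\<^sub>v ?x = 0\<^sub>v m\<^sub>1"
  proof -
    have "K\<^sub>1 *\<^sub>v ?x = (K\<^sub>1 * transpose_mat N\<^sub>1) *\<^sub>v z" using K\<^sub>1 N\<^sub>1 z by simp
    also have "\<dots> = 0\<^sub>v m\<^sub>1"
      using pair\<^sub>1 z unfolding completed_pair_def by (intro eq_vecI) auto
    finally show ?thesis .
  qed
  ultimately have "L *\<^sub>v (lift *\<^sub>v z) = 0\<^sub>v (m + m\<^sub>2) @\<^sub>v 0\<^sub>v m\<^sub>1"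
    unfolding lift_mult[OF z] using L_mult[OF x, of "- (Nhat\<^sub>2 *\<^sub>v ?w)"] w Nhat\<^sub>2 by simp
  then show ?thesis by (simp add: append_zero_vec)
qed

lemma L_append_zeroD:
  assumes x: "x \<in> carrier_vec (n + m\<^sub>1)" and y: "y \<in> carrier_vec m\<^sub>2"
    and zero: "L *\<^sub>v (x @\<^sub>v y) = 0\<^sub>v (m + m\<^sub>2 + m\<^sub>1)"
  shows "M *\<^sub>v x + transpose_mat K\<^sub>2 *\<^sub>v y = 0\<^sub>v (m + m\<^sub>2)" and "K\<^sub>1 *\<^sub>v x = 0\<^sub>v m\<^sub>1"
proof -
  have "(M *\<^sub>v x + transpose_mat K\<^sub>2 *\<^sub>v y) @\<^sub>v (K\<^sub>1 *\<^sub>v x) = 0\<^sub>v (m + m\<^sub>2) @\<^sub>v 0\<^sub>v m\<^sub>1"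
    using zero L_mult[OF x y] by (simp add: append_zero_vec)
  then show "M *\<^sub>v x + transpose_mat K\<^sub>2 *\<^sub>v y = 0\<^sub>v (m + m\<^sub>2)" "K\<^sub>1 *\<^sub>v x = 0\<^sub>v m\<^sub>1"
    using M K\<^sub>2 x y by (auto simp: append_vec_eq[of _ "m + m\<^sub>2"])
qed

lemma project_kernel:
  assumes v: "v \<in> carrier_vec (n + m\<^sub>1 + m\<^sub>2)" and Lv: "L *\<^sub>v v = 0\<^sub>v (m + m\<^sub>2 + m\<^sub>1)"
  shows "Q *\<^sub>v (project *\<^sub>v v) = 0\<^sub>v m" and "lift *\<^sub>v (project *\<^sub>v v) = v"
proof -
  define x where "x = vec_first v (n + m\<^sub>1)"
  define y where "y = vec_last v m\<^sub>2"
  have x: "x \<in> carrier_vec (n + m\<^sub>1)" and y: "y \<in> carrier_vec m\<^sub>2" and v_eq: "v = x @\<^sub>v y"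
    using v by (auto simp: x_def y_def)
  note top = L_append_zeroD(1)[OF x y Lv[unfolded v_eq]]
    and bot = L_append_zeroD(2)[OF x y Lv[unfolded v_eq]]
  define z where "z = Khat\<^sub>1 *\<^sub>v x"
  have z: "z \<in> carrier_vec n" using Khat\<^sub>1 x by (simp add: z_def)
  have proj: "project *\<^sub>v v = z" unfolding v_eq z_def by (rule project_mult[OF x y])
  have "x = (transpose_mat Nhat\<^sub>1 * K\<^sub>1 + transpose_mat N\<^sub>1 * Khat\<^sub>1) *\<^sub>v x"
    using pair\<^sub>1 x unfolding completed_pair_def by simp
  also have "\<dots> = transpose_mat Nhat\<^sub>1 *\<^sub>v (K\<^sub>1 *\<^sub>v x) + transpose_mat N\<^sub>1 *\<^sub>v z"
    using K\<^sub>1 N\<^sub>1 Khat\<^sub>1 Nhat\<^sub>1 x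
    by (simp add: z_def add_mult_distrib_mat_vec[of _ "n + m\<^sub>1" "n + m\<^sub>1"])
  also have "transpose_mat Nhat\<^sub>1 *\<^sub>v (K\<^sub>1 *\<^sub>v x) = 0\<^sub>v (n + m\<^sub>1)"
    unfolding bot using Nhat\<^sub>1 by (intro eq_vecI) auto
  finally have x_eq: "transpose_mat N\<^sub>1 *\<^sub>v z = x" using N\<^sub>1 z by simp
  have Mx: "M *\<^sub>v x \<in> carrier_vec (m + m\<^sub>2)" using M x by simp
  have Ky: "transpose_mat K\<^sub>2 *\<^sub>v y \<in> carrier_vec (m + m\<^sub>2)" using K\<^sub>2 y by simp
  have apply_top: "X *\<^sub>v (M *\<^sub>v x) + (X * transpose_mat K\<^sub>2) *\<^sub>v y = 0\<^sub>v r"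
    if X: "X \<in> carrier_mat r (m + m\<^sub>2)" for X r
  proof -
    have "X *\<^sub>v (M *\<^sub>v x) + (X * transpose_mat K\<^sub>2) *\<^sub>v y = X *\<^sub>v (M *\<^sub>v x + transpose_mat K\<^sub>2 *\<^sub>v y)"
      using X Mx Ky K\<^sub>2 y by (simp add: mult_add_distrib_mat_vec[OF X Mx Ky])
    also have "\<dots> = 0\<^sub>v r" unfolding top using X by (intro eq_vecI) auto
    finally show ?thesis .
  qed
  have "0\<^sub>m m m\<^sub>2 *\<^sub>v y = 0\<^sub>v m" using y by (intro eq_vecI) auto
  then have "N\<^sub>2 *\<^sub>v (M *\<^sub>v x) = 0\<^sub>v m"
    using apply_top[OF N\<^sub>2] completed_pair_transpose(2)[OF pair\<^sub>2] N\<^sub>2 Mx by simp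
  then show "Q *\<^sub>v (project *\<^sub>v v) = 0\<^sub>v m" unfolding proj Q_mult[OF z] x_eq .
  have NMx: "Nhat\<^sub>2 *\<^sub>v (M *\<^sub>v x) \<in> carrier_vec m\<^sub>2" using Nhat\<^sub>2 Mx by simp
  have "Nhat\<^sub>2 *\<^sub>v (M *\<^sub>v x) + y = 0\<^sub>v m\<^sub>2"
    using apply_top[OF Nhat\<^sub>2] completed_pair_transpose(1)[OF pair\<^sub>2] y by simp
  then have sum0: "(Nhat\<^sub>2 *\<^sub>v (M *\<^sub>v x) + y) $ i = 0" if "i < m\<^sub>2" for i using that by simp
  have "- (Nhat\<^sub>2 *\<^sub>v (M *\<^sub>v x)) = y"
  proof (rule eq_vecI)
    fix i assume i: "i < dim_vec y"
    then show "(- (Nhat\<^sub>2 *\<^sub>v (M *\<^sub>v x))) $ i = y $ i"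
      using sum0[of i] y Nhat\<^sub>2 by (simp add: minus_unique)
  qed (use y Nhat\<^sub>2 in auto)
  then show "lift *\<^sub>v (project *\<^sub>v v) = v"
    using lift_mult[OF z] by (simp add: proj x_eq v_eq[symmetric])
qed

end

section \<open>Transfer of minimal bases between the two kernels\<close>

lemma vec_degree_append: "vec_degree (x @\<^sub>v y) = max (vec_degree x) (vec_degree y)"
proof (rule antisym)
  show "vec_degree (x @\<^sub>v y) \<le> max (vec_degree x) (vec_degree y)"
    unfolding vec_degree_le_iff
    using degree_le_vec_degree[of _ x] degree_le_vec_degree[of _ y] by (auto simp: le_max_iff_disj)
  have "degree (x $ i) \<le> vec_degree (x @\<^sub>v y)" if "i < dim_vec x" for i
    using degree_le_vec_degree[of i "x @\<^sub>v y"] that by simp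
  moreover have "degree (y $ i) \<le> vec_degree (x @\<^sub>v y)" if "i < dim_vec y" for i
    using degree_le_vec_degree[of "dim_vec x + i" "x @\<^sub>v y"] that by simp
  ultimately show "max (vec_degree x) (vec_degree y) \<le> vec_degree (x @\<^sub>v y)"
    by (simp add: vec_degree_le_iff)
qed

lemma completed_block_matrix_map_to_fract:
  fixes M :: "'a :: field poly mat"
  assumes "completed_block_matrix m n m\<^sub>1 m\<^sub>2 M K\<^sub>1 K\<^sub>2 N\<^sub>1 N\<^sub>2 Khat\<^sub>1 Khat\<^sub>2 Nhat\<^sub>1 Nhat\<^sub>2"
  shows "completed_block_matrix m n m\<^sub>1 m\<^sub>2 (map_mat to_fract M) (map_mat to_fract K\<^sub>1) (map_mat to_fract K\<^sub>2)
    (map_mat to_fract N\<^sub>1) (map_mat to_fract N\<^sub>2) (map_mat to_fract Khat\<^sub>1) (map_mat to_fract Khat\<^sub>2)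
    (map_mat to_fract Nhat\<^sub>1) (map_mat to_fract Nhat\<^sub>2)"
  using assms completed_pair_map_to_fract unfolding completed_block_matrix_def by auto

text \<open>
  The upper part \<open>x = N\<^sub>1\<^sup>T z\<close> of the lifted vector has degree \<open>d + deg z\<close>, and the lower part \<open>y\<close> does
  not exceed it: from \<open>K\<^sub>2\<^sup>T y = - M x\<close> and the predictable degree property of \<open>K\<^sub>2\<^sup>T\<close> follows
  \<open>l + deg y \<le> l + deg x\<close>. Here it matters that the row degrees of \<open>K\<^sub>2\<close> are as large as the grade of \<open>M\<close>.
\<close>

lemma lift_degree:
  fixes M :: "'a :: field poly mat"
  assumes "completed_block_matrix m n m\<^sub>1 m\<^sub>2 M K\<^sub>1 K\<^sub>2 N\<^sub>1 N\<^sub>2 Khat\<^sub>1 Khat\<^sub>2 Nhat\<^sub>1 Nhat\<^sub>2"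
    and grade: "has_grade l M"
    and N1: "shifts_degree d (transpose_mat N\<^sub>1)" and K2: "shifts_degree l (transpose_mat K\<^sub>2)"
    and z: "z \<in> carrier_vec n" "z \<noteq> 0\<^sub>v n" 
    and Qz: "completed_block_matrix.Q M N\<^sub>1 N\<^sub>2 *\<^sub>v z = 0\<^sub>v m"
  shows "vec_degree (completed_block_matrix.lift M N\<^sub>1 Nhat\<^sub>2 *\<^sub>v z) = d + vec_degree z"
proof -
  interpret completed_block_matrix m n m\<^sub>1 m\<^sub>2 M K\<^sub>1 K\<^sub>2 N\<^sub>1 N\<^sub>2 Khat\<^sub>1 Khat\<^sub>2 Nhat\<^sub>1 Nhat\<^sub>2 by fact
  define x where "x = transpose_mat N\<^sub>1 *\<^sub>v z"
  define y where "y = - (Nhat\<^sub>2 *\<^sub>v (M *\<^sub>v x))"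
  have x: "x \<in> carrier_vec (n + m\<^sub>1)" using N\<^sub>1 z by (simp add: x_def)
  have y: "y \<in> carrier_vec m\<^sub>2" using Nhat\<^sub>2 M x by (simp add: y_def)
  have lift_z: "lift *\<^sub>v z = x @\<^sub>v y" using lift_mult[OF z(1)] by (simp add: x_def y_def)
  have deg_x: "vec_degree x = d + vec_degree z"
    using N1 z N\<^sub>1 unfolding shifts_degree_def by (simp add: x_def)
  have "vec_degree y \<le> vec_degree x"
  proof (cases "y = 0\<^sub>v m\<^sub>2")
    case True
    then have "vec_degree y \<le> 0" unfolding vec_degree_le_iff by simp
    then show ?thesis by simp
  next
    case False
    have "M *\<^sub>v x + transpose_mat K\<^sub>2 *\<^sub>v y = 0\<^sub>v (m + m\<^sub>2)"
      using L_append_zeroD(1)[OF x y] L_lift[OF z(1) Qz] lift_z by simp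
    then have *: "(M *\<^sub>v x + transpose_mat K\<^sub>2 *\<^sub>v y) $ i = 0" if "i < m + m\<^sub>2" for i
      using that by simp
    have "(transpose_mat K\<^sub>2 *\<^sub>v y) $ i = - (M *\<^sub>v x) $ i" if "i < m + m\<^sub>2" for i
      using *[OF that] that M K\<^sub>2 by (simp add: eq_neg_iff_add_eq_0 add.commute)
    then have "vec_degree (transpose_mat K\<^sub>2 *\<^sub>v y) \<le> vec_degree (M *\<^sub>v x)"
      unfolding vec_degree_le_iff using M K\<^sub>2 degree_le_vec_degree[of _ "M *\<^sub>v x"] by simp
    moreover have "vec_degree (transpose_mat K\<^sub>2 *\<^sub>v y) = l + vec_degree y"
      using K2 y False K\<^sub>2 unfolding shifts_degree_def by simp
    moreover have "vec_degree (M *\<^sub>v x) \<le> l + vec_degree x"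
      by (rule degree_mult_mat_vec_le[OF M x grade])
    ultimately show ?thesis by simp
  qed
  then show ?thesis unfolding lift_z vec_degree_append deg_x by simp
qed

lemma right_minimal_basis_project:
  fixes M :: "'a :: field poly mat"
  assumes cbm: "completed_block_matrix m n m\<^sub>1 m\<^sub>2 M K\<^sub>1 K\<^sub>2 N\<^sub>1 N\<^sub>2 Khat\<^sub>1 Khat\<^sub>2 Nhat\<^sub>1 Nhat\<^sub>2"
    and grade: "has_grade l M"
    and N1: "shifts_degree d (transpose_mat N\<^sub>1)" and K2: "shifts_degree l (transpose_mat K\<^sub>2)"
    and R: "right_minimal_basis (block_matrix M K\<^sub>1 K\<^sub>2) R"
  shows "right_minimal_basis (N\<^sub>2 * M * transpose_mat N\<^sub>1) ((Khat\<^sub>1 @\<^sub>c 0\<^sub>m n m\<^sub>2) * R)"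
proof -
  let ?h = "map_mat (to_fract :: 'a poly \<Rightarrow> _)"
  interpret P: completed_block_matrix m n m\<^sub>1 m\<^sub>2 M K\<^sub>1 K\<^sub>2 N\<^sub>1 N\<^sub>2 Khat\<^sub>1 Khat\<^sub>2 Nhat\<^sub>1 Nhat\<^sub>2
    by (rule cbm)
  interpret F: completed_block_matrix m n m\<^sub>1 m\<^sub>2 "?h M" "?h K\<^sub>1" "?h K\<^sub>2" "?h N\<^sub>1" "?h N\<^sub>2"
    "?h Khat\<^sub>1" "?h Khat\<^sub>2" "?h Nhat\<^sub>1" "?h Nhat\<^sub>2"
    by (rule completed_block_matrix_map_to_fract[OF cbm])
  have triple: "?h X * ?h M * transpose_mat (?h N\<^sub>1) = ?h (X * M * transpose_mat N\<^sub>1)"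
    if "X \<in> carrier_mat r (m + m\<^sub>2)" for X r
    using to_fract.mat_hom_mult[of "X * M" r "n + m\<^sub>1" "transpose_mat N\<^sub>1" n]
      to_fract.mat_hom_mult[OF that P.M] that P.M P.N\<^sub>1
    by (simp add: map_mat_transpose)
  have L: "?h P.L = F.L"
    unfolding P.L_def F.L_def block_matrix_def
    using P.M P.K\<^sub>1 P.K\<^sub>2 by (intro eq_matI) auto
  have Q: "?h P.Q = F.Q" unfolding P.Q_def F.Q_def using triple[OF P.N\<^sub>2] by simp
  have project: "?h P.project = F.project"
    unfolding P.project_def F.project_def append_cols_def
    using P.Khat\<^sub>1 by (intro eq_matI) auto
  have lift: "?h P.lift = F.lift"
    unfolding P.lift_def F.lift_def triple[OF P.Nhat\<^sub>2] append_rows_def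
    using P.N\<^sub>1 P.Nhat\<^sub>2 P.M by (intro eq_matI) auto
  have kerL: "w \<in> mat_kernel (?h P.L) \<longleftrightarrow>
      w \<in> carrier_vec (n + m\<^sub>1 + m\<^sub>2) \<and> F.L *\<^sub>v w = 0\<^sub>v (m + m\<^sub>2 + m\<^sub>1)" for w
    using mat_kernel[OF F.L_carrier] unfolding L by auto
  have kerQ: "w \<in> mat_kernel (?h P.Q) \<longleftrightarrow> w \<in> carrier_vec n \<and> F.Q *\<^sub>v w = 0\<^sub>v m" for w
    using mat_kernel[OF F.Q_carrier] unfolding Q by auto
  have R': "R \<in> carrier_mat (n + m\<^sub>1 + m\<^sub>2) (dim_col R)"
    and minR: "minimal_basis_of (n + m\<^sub>1 + m\<^sub>2) (mat_kernel (?h P.L)) (cols R)"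
    using R P.L_carrier unfolding right_minimal_basis_def P.L_def[symmetric] by auto
  have "minimal_basis_of n (mat_kernel (?h P.Q)) (cols (P.project * R))"
  proof (rule minimal_basis_transfer[OF _ _ P.project_carrier P.lift_carrier _ _ _ _ _ R' minR])
    show "submodule class_ring (mat_kernel (?h P.L)) (module_vec TYPE('a poly fract) (n + m\<^sub>1 + m\<^sub>2))"
      unfolding L by (rule mat_kernel_submodule[OF F.L_carrier])
    show "submodule class_ring (mat_kernel (?h P.Q)) (module_vec TYPE('a poly fract) n)"
      unfolding Q by (rule mat_kernel_submodule[OF F.Q_carrier])
    show "?h P.project *\<^sub>v w \<in> mat_kernel (?h P.Q)" and "?h P.lift *\<^sub>v (?h P.project *\<^sub>v w) = w"
      if "w \<in> mat_kernel (?h P.L)" for w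
      using that F.project_kernel F.project_carrier unfolding kerL kerQ project lift by auto
    show "?h P.lift *\<^sub>v w \<in> mat_kernel (?h P.L)" and "?h P.project *\<^sub>v (?h P.lift *\<^sub>v w) = w"
      if "w \<in> mat_kernel (?h P.Q)" for w
      using that F.L_lift F.project_lift F.lift_carrier unfolding kerL kerQ project lift by auto
    show "vec_degree (P.lift *\<^sub>v z) = d + vec_degree z"
      if z: "z \<in> carrier_vec n" "z \<noteq> 0\<^sub>v n" "map_vec to_fract z \<in> mat_kernel (?h P.Q)" for z
    proof -
      have "F.Q *\<^sub>v map_vec to_fract z = 0\<^sub>v m" using z(3) kerQ by blast
      then have "map_vec to_fract (P.Q *\<^sub>v z) = map_vec to_fract (0\<^sub>v m)"
        using to_fract.mult_mat_vec_hom[OF P.Q_carrier z(1)] Q by (simp add: to_fract.vec_hom_zero)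
      then have "P.Q *\<^sub>v z = 0\<^sub>v m" by (rule to_fract.vec_hom_inj)
      then show ?thesis by (rule lift_degree[OF cbm grade N1 K2 z(1,2)])
    qed
  qed
  moreover have "dim_row P.project = n" "dim_col P.Q = n" using P.project_carrier P.Q_carrier by auto
  ultimately show ?thesis
    unfolding right_minimal_basis_def P.Q_def[symmetric] P.project_def[symmetric] by simp
qed

text \<open>
  An absent block \<open>K\<^sub>1\<close> leads to \<open>N\<^sub>1 = I\<close>, which shifts degrees by 0; for an absent \<open>K\<^sub>2\<close> the degree
  condition is vacuous, since \<open>K\<^sub>2\<^sup>T\<close> has no columns.
\<close>

lemma strong_block_right_minimal_basis:
  fixes M :: "'a :: field poly mat"
  assumes strong: "strong_block_minimal_bases l m n m\<^sub>1 m\<^sub>2 M K\<^sub>1 K\<^sub>2"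
    and comp1: "dual_unimodular_completion K\<^sub>1 N\<^sub>1 Khat\<^sub>1 Nhat\<^sub>1"
    and comp2: "dual_unimodular_completion K\<^sub>2 N\<^sub>2 Khat\<^sub>2 Nhat\<^sub>2"
    and R: "right_minimal_basis (block_matrix M K\<^sub>1 K\<^sub>2) R"
  shows "right_minimal_basis (N\<^sub>2 * M * transpose_mat N\<^sub>1) ((Khat\<^sub>1 @\<^sub>c 0\<^sub>m n m\<^sub>2) * R)"
proof -
  have M: "M \<in> carrier_mat (m + m\<^sub>2) (n + m\<^sub>1)" and grade: "has_grade l M"
    and K1: "K\<^sub>1 \<in> carrier_mat m\<^sub>1 (n + m\<^sub>1)" and K2: "K\<^sub>2 \<in> carrier_mat m\<^sub>2 (m + m\<^sub>2)"
    and block1: "0 < m\<^sub>1 \<Longrightarrow> minimal_basis_block l K\<^sub>1" and block2: "0 < m\<^sub>2 \<Longrightarrow> minimal_basis_block l K\<^sub>2"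
    using strong unfolding strong_block_minimal_bases_def by auto
  have pair: "completed_pair k p K N Khat Nhat"
    if "dual_unimodular_completion K N Khat Nhat" "K \<in> carrier_mat k (p + k)"
    for k p and K N Khat Nhat :: "'a poly mat"
  proof -
    have N: "N \<in> carrier_mat p (p + k)"
      using that unfolding dual_unimodular_completion_def dual_minimal_bases_def
      by (auto split: if_splits)
    then show ?thesis
      using that completion_identities[OF that N]
      unfolding completed_pair_def dual_unimodular_completion_def by auto
  qed
  note pair1 = pair[OF comp1 K1] and pair2 = pair[OF comp2 K2]
  have cbm: "completed_block_matrix m n m\<^sub>1 m\<^sub>2 M K\<^sub>1 K\<^sub>2 N\<^sub>1 N\<^sub>2 Khat\<^sub>1 Khat\<^sub>2 Nhat\<^sub>1 Nhat\<^sub>2"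
    using M pair1 pair2 by unfold_locales
  have "\<exists>d. shifts_degree d (transpose_mat N\<^sub>1)"
  proof (cases "m\<^sub>1 = 0")
    case True
    then have "N\<^sub>1 = 1\<^sub>m n" using comp1 K1 unfolding dual_unimodular_completion_def by auto
    then show ?thesis using shifts_degree_one by auto
  next
    case False
    then show ?thesis
      using pair1 comp1 block1 K1 dual_minimal_basis_shifts_degree[of K\<^sub>1 m\<^sub>1 "n + m\<^sub>1" N\<^sub>1 n Khat\<^sub>1 Nhat\<^sub>1 l]
      unfolding completed_pair_def dual_unimodular_completion_def by auto
  qed
  then obtain d where d: "shifts_degree d (transpose_mat N\<^sub>1)" by blast
  have "shifts_degree l (transpose_mat K\<^sub>2)"
  proof (cases "m\<^sub>2 = 0")
    case True
    then show ?thesis using K2 unfolding shifts_degree_def by auto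
  next
    case False
    then show ?thesis
      using minimal_basis_shifts_degree[OF K2] block2 unfolding minimal_basis_block_def by simp
  qed
  then show ?thesis using right_minimal_basis_project[OF cbm grade d _ R] by simp
qed

lemma strong_block_minimal_bases_transpose:
  assumes "strong_block_minimal_bases l m n m\<^sub>1 m\<^sub>2 M K\<^sub>1 K\<^sub>2"
  shows "strong_block_minimal_bases l n m m\<^sub>2 m\<^sub>1 (transpose_mat M) K\<^sub>2 K\<^sub>1"
  using assms unfolding strong_block_minimal_bases_def has_grade_def by auto

lemma block_matrix_transpose:
  assumes "M \<in> carrier_mat (m + m\<^sub>2) (n + m\<^sub>1)" "K\<^sub>1 \<in> carrier_mat m\<^sub>1 (n + m\<^sub>1)"
    "K\<^sub>2 \<in> carrier_mat m\<^sub>2 (m + m\<^sub>2)"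
  shows "transpose_mat (block_matrix M K\<^sub>1 K\<^sub>2) = block_matrix (transpose_mat M) K\<^sub>2 K\<^sub>1"
  using assms unfolding block_matrix_def by (intro eq_matI) auto

lemma left_minimal_basis_iff_transpose:
  "left_minimal_basis P L \<longleftrightarrow> right_minimal_basis (transpose_mat P) (transpose_mat L)"
  unfolding left_minimal_basis_def right_minimal_basis_def by (simp add: map_mat_transpose)

theorem theorem6p5:
  fixes M K\<^sub>1 K\<^sub>2 N\<^sub>1 N\<^sub>2 Khat\<^sub>1 Khat\<^sub>2 Nhat\<^sub>1 Nhat\<^sub>2 \<L> Q R\<^sub>\<L> L\<^sub>\<L> R\<^sub>Q L\<^sub>Q :: "'a :: field poly mat"
    and l m n m\<^sub>1 m\<^sub>2 p q :: nat
  assumes "strong_block_minimal_bases l m n m\<^sub>1 m\<^sub>2 M K\<^sub>1 K\<^sub>2"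
    and "\<L> = block_matrix M K\<^sub>1 K\<^sub>2"
    and "dual_unimodular_completion K\<^sub>1 N\<^sub>1 Khat\<^sub>1 Nhat\<^sub>1"
    and "dual_unimodular_completion K\<^sub>2 N\<^sub>2 Khat\<^sub>2 Nhat\<^sub>2"
    and "Q = N\<^sub>2 * M * transpose_mat N\<^sub>1"
    and "dim_col R\<^sub>\<L> = p" and "right_minimal_basis \<L> R\<^sub>\<L>"
    and "dim_row L\<^sub>\<L> = q" and "left_minimal_basis \<L> L\<^sub>\<L>"
    and "R\<^sub>Q = (Khat\<^sub>1 @\<^sub>c 0\<^sub>m n m\<^sub>2) * R\<^sub>\<L>"
    and "L\<^sub>Q = L\<^sub>\<L> * (transpose_mat Khat\<^sub>2 @\<^sub>r 0\<^sub>m m\<^sub>1 m)"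
  shows "(dim_col R\<^sub>Q = p \<and> right_minimal_basis Q R\<^sub>Q) \<and>
         (dim_row L\<^sub>Q = q \<and> left_minimal_basis Q L\<^sub>Q)"
proof (intro conjI)
  show "dim_col R\<^sub>Q = p" "dim_row L\<^sub>Q = q" using assms by simp_all
  show "right_minimal_basis Q R\<^sub>Q"
    using strong_block_right_minimal_basis[OF assms(1,3,4)] assms by simp
  have M: "M \<in> carrier_mat (m + m\<^sub>2) (n + m\<^sub>1)" and K1: "K\<^sub>1 \<in> carrier_mat m\<^sub>1 (n + m\<^sub>1)"
    and K2: "K\<^sub>2 \<in> carrier_mat m\<^sub>2 (m + m\<^sub>2)"
    using assms(1) unfolding strong_block_minimal_bases_def by auto
  have dims: "dim_col N\<^sub>1 = n + m\<^sub>1" "dim_col N\<^sub>2 = m + m\<^sub>2"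
    "dim_col Khat\<^sub>2 = m + m\<^sub>2" "dim_row Khat\<^sub>2 = m"
    using assms(3,4) K1 K2
    unfolding dual_unimodular_completion_def dual_minimal_bases_def by (auto split: if_splits)
  \<comment> \<open>Transposition exchanges the roles of the two blocks and turns left into right minimal bases.\<close>
  have "right_minimal_basis (block_matrix (transpose_mat M) K\<^sub>2 K\<^sub>1) (transpose_mat L\<^sub>\<L>)"
    using assms(2,9) block_matrix_transpose[OF M K1 K2]
    by (simp add: left_minimal_basis_iff_transpose)
  from strong_block_right_minimal_basis[OF strong_block_minimal_bases_transpose[OF assms(1)] assms(4,3) this]
  have "right_minimal_basis (N\<^sub>1 * transpose_mat M * transpose_mat N\<^sub>2)
      ((Khat\<^sub>2 @\<^sub>c 0\<^sub>m m m\<^sub>1) * transpose_mat L\<^sub>\<L>)" .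
  moreover have "N\<^sub>1 * transpose_mat M * transpose_mat N\<^sub>2 = transpose_mat Q"
  proof -
    have N1: "N\<^sub>1 \<in> carrier_mat (dim_row N\<^sub>1) (n + m\<^sub>1)" and N2: "N\<^sub>2 \<in> carrier_mat (dim_row N\<^sub>2) (m + m\<^sub>2)"
      using dims by auto
    have "transpose_mat Q = transpose_mat (transpose_mat N\<^sub>1) * transpose_mat (N\<^sub>2 * M)"
      unfolding assms(5) by (rule transpose_mult) (use N1 N2 M in auto)
    also have "transpose_mat (N\<^sub>2 * M) = transpose_mat M * transpose_mat N\<^sub>2"
      by (rule transpose_mult[OF N2 M])
    finally have "transpose_mat Q = N\<^sub>1 * (transpose_mat M * transpose_mat N\<^sub>2)"
      unfolding Matrix.transpose_transpose .
    moreover have "N\<^sub>1 * transpose_mat M * transpose_mat N\<^sub>2 = N\<^sub>1 * (transpose_mat M * transpose_mat N\<^sub>2)"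
      by (rule assoc_mult_mat[OF N1]) (use N2 M in auto)
    ultimately show ?thesis by metis
  qed
  moreover have "(Khat\<^sub>2 @\<^sub>c 0\<^sub>m m m\<^sub>1) * transpose_mat L\<^sub>\<L> = transpose_mat L\<^sub>Q"
  proof -
    have L: "L\<^sub>\<L> \<in> carrier_mat q (m + m\<^sub>2 + m\<^sub>1)"
      using assms(2,8,9) M K1 unfolding left_minimal_basis_def block_matrix_def by auto
    have "Khat\<^sub>2 @\<^sub>c 0\<^sub>m m m\<^sub>1 = transpose_mat (transpose_mat Khat\<^sub>2 @\<^sub>r 0\<^sub>m m\<^sub>1 m)"
      unfolding append_cols_def append_rows_def using dims by (intro eq_matI) auto
    moreover have "transpose_mat Khat\<^sub>2 @\<^sub>r 0\<^sub>m m\<^sub>1 m \<in> carrier_mat (m + m\<^sub>2 + m\<^sub>1) m"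
      using dims by (intro carrier_append_rows) auto
    ultimately show ?thesis using L assms(11) by (simp add: transpose_mult)
  qed
  ultimately show "left_minimal_basis Q L\<^sub>Q" by (simp add: left_minimal_basis_iff_transpose)
qed

end
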